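(* Let $k\in\{2,3,4\}$ and let $R$ be a complete intersection SAGA of codimension $n+1$ presented by quadrics. If $n\ge k+1$, then $R$ satisfies $SLP_1(k)$, i.e. for general $x\in R^1$ the multiplication map $x^k\cdot:R^1\to R^{k+1}$ is injective.
   Context: $\mathbb K$ is an algebraically closed field of characteristic $0$. A complete intersection SAGA of codimension $n+1$ presented by quadrics is $R=S/I$, $S=\mathbb K[x_0,\dots,x_n]$, $I$ generated by a regular sequence of $n+1$ homogeneous quadrics (standard graded Artinian Gorenstein, socle degree $n+1$). *)

theory Defs
  imports "HOL-Library.Poly_Mapping" "HOL-Computational_Algebra.Polynomial"
begin

type_synonym ('v, 'k) mpoly = "('v \<Rightarrow>\<^sub>0 nat) \<Rightarrow>\<^sub>0 'k"

definition alg_closed_field :: "'k::field itself \<Rightarrow> bool" where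
  "alg_closed_field _ \<longleftrightarrow> (\<forall>p :: 'k poly. degree p \<ge> 1 \<longrightarrow> (\<exists>x. poly p x = 0))"

definition mdeg :: "('v \<Rightarrow>\<^sub>0 nat) \<Rightarrow> nat" where
  "mdeg m = (\<Sum>v\<in>Poly_Mapping.keys m. Poly_Mapping.lookup m v)"

definition homogeneous :: "nat \<Rightarrow> ('v, 'k::zero) mpoly \<Rightarrow> bool" where
  "homogeneous d p \<longleftrightarrow> (\<forall>m\<in>Poly_Mapping.keys p. mdeg m = d)"

definition var :: "'v \<Rightarrow> ('v, 'k::{zero,one}) mpoly" where
  "var v = Poly_Mapping.single (Poly_Mapping.single v 1) 1"

definition linform :: "('v::finite \<Rightarrow> 'k::comm_ring_1) \<Rightarrow> ('v, 'k) mpoly" where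
  "linform c = (\<Sum>v\<in>UNIV. Poly_Mapping.single 0 (c v) * var v)"

definition mpeval :: "('v, 'k::comm_ring_1) mpoly \<Rightarrow> ('v \<Rightarrow> 'k) \<Rightarrow> 'k" where
  "mpeval F c = (\<Sum>m\<in>Poly_Mapping.keys F. Poly_Mapping.lookup F m * (\<Prod>v\<in>Poly_Mapping.keys m. c v ^ Poly_Mapping.lookup m v))"

definition gen_ideal :: "('v, 'k::comm_ring_1) mpoly list \<Rightarrow> ('v, 'k) mpoly set" where
  "gen_ideal qs = {\<Sum>i<length qs. a i * qs ! i | a. True}"

definition regular_sequence :: "('v, 'k::comm_ring_1) mpoly list \<Rightarrow> bool" where
  "regular_sequence qs \<longleftrightarrow> 1 \<notin> gen_ideal qs \<and>
     (\<forall>i<length qs. \<forall>f. f * qs ! i \<in> gen_ideal (take i qs) \<longrightarrow> f \<in> gen_ideal (take i qs))"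

text \<open>SLP_1(k): for general x in R^1 (i.e. for all coefficient vectors c outside
a proper Zariski closed subset {F = 0}, F a nonzero polynomial), multiplication by
x^k from R^1 = S_1/I_1 to R^(k+1) is injective.\<close>
definition SLP1 :: "nat \<Rightarrow> ('v::finite, 'k::field) mpoly list \<Rightarrow> bool" where
  "SLP1 k qs \<longleftrightarrow> (\<exists>F :: ('v, 'k) mpoly. F \<noteq> 0 \<and>
     (\<forall>c. mpeval F c \<noteq> 0 \<longrightarrow>
        (\<forall>y1 y2. homogeneous 1 y1 \<longrightarrow> homogeneous 1 y2 \<longrightarrow>
           linform c ^ k * y1 - linform c ^ k * y2 \<in> gen_ideal qs \<longrightarrow>
           y1 - y2 \<in> gen_ideal qs)))"

end

(*
Write R = S/I and N = n + 1. Suppose that x^k has a kernel in degree one for all linear forms x. Elimination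
over the polynomial functions of x yields a polynomial vector field y(x) <> 0 with x^k y(x) = 0 in R.
Differentiating in the direction w, multiplying by y and using that R has no socle below degree N,
one gets x^a y^b = 0 for all a + b = k + 1, b >= 1, and

    a x^(a-1) y^b w + b x^a y^(b-1) D_w y = 0    for all linear forms w.

At a general point let V be the space of all w with D_w y proportional to y, and let T be spanned by y and
all D_w y, so that dim V + dim T > N. Then V annihilates every x^(a-1) y^b with a >= 1, and T annihilates
the last nonzero power of y. Complete intersections of quadrics satisfy: a nonzero element of degree e is
annihilated by at most e independent linear forms, and e independent linear forms have an at most
one-dimensional annihilator in degree e. Hence dim V <= k and dim T <= k, and with n >= k + 1 and k <= 4
there remain the case dim V = k, where all x^(k-b) y^b are proportional, and the case k = 4, N = 6,
dim V = 3, dim T = 4, where T is the annihilator of y^4. Both contradict the relations above.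

The two facts on complete intersections are proved by lifting multiplication by z, from S/(l_1, ..., l_w)
to R, to a map of Koszul complexes. Its component in homological degree i consists of forms of degree
deg z - i, since the l_j have degree one and the quadrics degree two; once a component vanishes, the map
is null-homotopic and z lies in I.
*)
theory Submission
  imports Defs "HOL-Analysis.Cartesian_Space"
begin

text \<open>Elimination ends either in a polynomial kernel vector or in a nonzero polynomial F whose
  nonvanishing makes x^k injective; F is then the open condition of the theorem. In the first case a
  single point c is fixed at which every x^a y^b with a, b <= 5 that is not identically zero in R is
  nonzero. A relation found at c thus holds for all x and may be differentiated. There k is replaced
  by the least exponent that kills y at c, since dim V <= k rests on x^(k-1) y <> 0.

  The bound k <= 4 enters by counting. As N >= k + 2, dim V + dim T >= k + 3, while both are at most
  k. If dim V <= k - 1, then 2k - 1 >= k + 3, so k = 4 with equality throughout. If dim V = k, the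
  relations force y^(k-1) = 0, so dim T <= k - 2, and 2k - 2 >= k + 3 fails. The constant 5 is k + 1
  for k = 4, the largest degree of a monomial to be differentiated.

  Membership in I is tested by linear functionals vanishing on I. They turn statements in R into
  statements about polynomial functions over an infinite field.\<close>

interpretation idl: module "(*) :: 'a::comm_ring_1 \<Rightarrow> 'a \<Rightarrow> 'a"
  by standard (simp_all add: algebra_simps)

(* as a simp rule, it would reassociate products and loop with mult.assoc *)
declare idl.scale_scale [simp del]

definition cst :: "'k \<Rightarrow> ('v, 'k::zero) mpoly" where
  "cst a = Poly_Mapping.single 0 a"

lemma cst_0 [simp]: "cst 0 = 0"
  and cst_1 [simp]: "cst 1 = 1"
  by (simp_all add: cst_def)

lemma cst_add: "cst (a + b :: 'k::comm_ring_1) = cst a + cst b"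
  by (simp add: cst_def single_add)

lemma cst_uminus: "cst (- a :: 'k::comm_ring_1) = - cst a"
  by (simp add: cst_def single_uminus)

lemma cst_mult: "cst (a * b :: 'k::comm_ring_1) = cst a * cst b"
  by (simp add: cst_def mult_single)

lemma cst_of_nat: "cst (of_nat n :: 'k::comm_ring_1) = of_nat n"
  by (simp add: cst_def)

lemma lookup_cst_mult: "Poly_Mapping.lookup (cst (a::'k::comm_ring_1) * p) m = a * Poly_Mapping.lookup p m"
proof -
  have "cst a * p = Poly_Mapping.map ((*) a) p"
    unfolding cst_def mult_map_scale_conv_mult ..
  moreover have "Poly_Mapping.lookup (Poly_Mapping.map ((*) a) p) m = a * Poly_Mapping.lookup p m"
    by transfer (auto simp: when_def)
  ultimately show ?thesis by (simp only:)
qed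

text \<open>Coexists with \<open>idl\<close>: \<open>kv.span\<close> and
  \<open>kv.independent\<close> are taken over the field, \<open>idl.span\<close> over the
  polynomial ring, so that a space of forms can be compared with the ideal it generates.\<close>

definition kscale :: "'k::field \<Rightarrow> ('v, 'k) mpoly \<Rightarrow> ('v, 'k) mpoly" where
  "kscale a p = cst a * p"

interpretation kv: vector_space kscale
  by unfold_locales (simp_all add: kscale_def distrib_left distrib_right cst_add cst_mult mult.assoc)

lemma mpoly_sum: "p = (\<Sum>m\<in>Poly_Mapping.keys p. Poly_Mapping.single m (Poly_Mapping.lookup p m))"
proof (rule poly_mapping_eqI)
  fix k
  show "Poly_Mapping.lookup p k = Poly_Mapping.lookup (\<Sum>m\<in>Poly_Mapping.keys p. Poly_Mapping.single m (Poly_Mapping.lookup p m)) k"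
    unfolding lookup_sum lookup_single when_def sum.delta[OF finite_keys]
    by (simp add: not_in_keys_iff_lookup_eq_zero)
qed

lemma mdeg_UNIV: "mdeg (m :: 'v::finite \<Rightarrow>\<^sub>0 nat) = (\<Sum>v\<in>UNIV. Poly_Mapping.lookup m v)"
  unfolding mdeg_def by (intro sum.mono_neutral_left) (auto simp: in_keys_iff)

lemma mdeg_add: "mdeg (m + m' :: 'v::finite \<Rightarrow>\<^sub>0 nat) = mdeg m + mdeg m'"
  by (simp add: mdeg_UNIV lookup_add sum.distrib)

lemma mdeg_0 [simp]: "mdeg 0 = 0"
  by (simp add: mdeg_def)

subsection \<open>Homogeneous components\<close>

text \<open>Degrees are integers, so that polynomials of negative degree are available and vanish.\<close>

definition hom :: "int \<Rightarrow> ('v, 'k::zero) mpoly \<Rightarrow> bool" where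
  "hom d p \<longleftrightarrow> (\<forall>m\<in>Poly_Mapping.keys p. int (mdeg m) = d)"

definition hcomp :: "int \<Rightarrow> ('v, 'k::zero) mpoly \<Rightarrow> ('v, 'k) mpoly" where
  "hcomp d p = Poly_Mapping.mapp (\<lambda>m a. if int (mdeg m) = d then a else 0) p"

lemma lookup_hcomp:
  "Poly_Mapping.lookup (hcomp d p) m = (if int (mdeg m) = d then Poly_Mapping.lookup p m else 0)"
  by (simp add: hcomp_def lookup_mapp when_def in_keys_iff)

lemma homogeneous_iff_hom: "homogeneous d p \<longleftrightarrow> hom (int d) p"
  by (simp add: homogeneous_def hom_def)

lemma hom_iff_hcomp: "hom d p \<longleftrightarrow> hcomp d p = p"
  by (force simp: hom_def poly_mapping_eq_iff fun_eq_iff lookup_hcomp in_keys_iff)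

lemma hom_hcomp [simp]: "hom d (hcomp d p)"
  by (auto simp: hom_def lookup_hcomp in_keys_iff split: if_splits)

lemma hom_0 [simp]: "hom d 0"
  by (simp add: hom_def)

lemma hom_neg: "hom d p \<Longrightarrow> d < 0 \<Longrightarrow> p = 0"
  by (rule poly_mapping_eqI) (force simp: hom_def in_keys_iff)

lemma hcomp_0 [simp]: "hcomp d 0 = 0"
  by (simp add: poly_mapping_eq_iff fun_eq_iff lookup_hcomp)

lemma hcomp_add: "hcomp d (p + q :: ('v, 'k::comm_ring_1) mpoly) = hcomp d p + hcomp d q"
  by (simp add: poly_mapping_eq_iff fun_eq_iff lookup_hcomp lookup_add)

lemma hcomp_diff: "hcomp d (p - q :: ('v, 'k::comm_ring_1) mpoly) = hcomp d p - hcomp d q"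
  by (simp add: poly_mapping_eq_iff fun_eq_iff lookup_hcomp lookup_minus)

lemma hcomp_sum: "hcomp d (\<Sum>i\<in>A. p i :: ('v, 'k::comm_ring_1) mpoly) = (\<Sum>i\<in>A. hcomp d (p i))"
  by (induction A rule: infinite_finite_induct) (simp_all add: hcomp_add)

lemma hcomp_single: "hcomp d (Poly_Mapping.single m a) = (if int (mdeg m) = d then Poly_Mapping.single m a else 0)"
  by (intro poly_mapping_eqI) (auto simp: lookup_hcomp lookup_single when_def)

lemma hcomp_mult:
  fixes f p :: "('v::finite, 'k::comm_ring_1) mpoly"
  assumes "hom \<delta> f"
  shows "hcomp d (f * p) = f * hcomp (d - \<delta>) p"
proof -
  let ?s = "\<lambda>q m. Poly_Mapping.single m (Poly_Mapping.lookup q m) :: ('v, 'k) mpoly"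
  have *: "hcomp d (?s f m * ?s p m') = ?s f m * hcomp (d - \<delta>) (?s p m')"
    if "m \<in> Poly_Mapping.keys f" for m m'
    using assms that by (auto simp: mult_single hcomp_single mdeg_add hom_def)
  have "hcomp d (f * p)
      = hcomp d ((\<Sum>m\<in>Poly_Mapping.keys f. ?s f m) * (\<Sum>m'\<in>Poly_Mapping.keys p. ?s p m'))"
    by (simp only: mpoly_sum[symmetric])
  also have "\<dots> = (\<Sum>m\<in>Poly_Mapping.keys f. \<Sum>m'\<in>Poly_Mapping.keys p. hcomp d (?s f m * ?s p m'))"
    by (simp only: sum_product hcomp_sum)
  also have "\<dots> = (\<Sum>m\<in>Poly_Mapping.keys f. \<Sum>m'\<in>Poly_Mapping.keys p. ?s f m * hcomp (d - \<delta>) (?s p m'))"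
    by (intro sum.cong refl *)
  also have "\<dots> = (\<Sum>m\<in>Poly_Mapping.keys f. ?s f m) * hcomp (d - \<delta>) (\<Sum>m'\<in>Poly_Mapping.keys p. ?s p m')"
    by (simp only: sum_product hcomp_sum)
  also have "\<dots> = f * hcomp (d - \<delta>) p"
    by (simp only: mpoly_sum[symmetric])
  finally show ?thesis .
qed

lemma hom_add: "hom d p \<Longrightarrow> hom d q \<Longrightarrow> hom d (p + q :: ('v, 'k::comm_ring_1) mpoly)"
  by (simp add: hom_iff_hcomp hcomp_add)

lemma hom_diff: "hom d p \<Longrightarrow> hom d q \<Longrightarrow> hom d (p - q :: ('v, 'k::comm_ring_1) mpoly)"
  by (simp add: hom_iff_hcomp hcomp_diff)

lemma hom_sum: "(\<And>i. i \<in> A \<Longrightarrow> hom d (p i)) \<Longrightarrow> hom d (\<Sum>i\<in>A. p i :: ('v, 'k::comm_ring_1) mpoly)"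
  by (simp add: hom_iff_hcomp hcomp_sum)

lemma hom_mult:
  "hom d p \<Longrightarrow> hom e q \<Longrightarrow> hom (d + e) (p * q :: ('v::finite, 'k::comm_ring_1) mpoly)"
  by (simp add: hom_iff_hcomp hcomp_mult)

lemma hom_cst [simp]: "hom 0 (cst a)"
  by (simp add: hom_def cst_def)

lemma hom_cst_mult: "hom d p \<Longrightarrow> hom d (cst a * p :: ('v::finite, 'k::comm_ring_1) mpoly)"
  using hom_mult[of 0 "cst a" d p] by simp

lemma hom_1 [simp]: "hom 0 (1 :: ('v, 'k::comm_ring_1) mpoly)"
  by (simp add: hom_def)

lemma hom_uminus: "hom d p \<Longrightarrow> hom d (- p :: ('v, 'k::comm_ring_1) mpoly)"
  using hom_diff[of d 0 p] by simp

lemma hom_power: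
  "hom d p \<Longrightarrow> hom (int n * d) (p ^ n :: ('v::finite, 'k::comm_ring_1) mpoly)"
  by (induction n) (simp_all add: hom_mult distrib_right)

lemma hom_0_cst:
  fixes p :: "('v::finite, 'k::comm_ring_1) mpoly"
  assumes "hom 0 p"
  shows "p = cst (Poly_Mapping.lookup p 0)"
proof (intro poly_mapping_eqI)
  fix m
  have "m = 0" if "Poly_Mapping.lookup p m \<noteq> 0"
  proof -
    have "mdeg m = 0"
      using that assms by (auto simp: hom_def in_keys_iff)
    then show ?thesis
      by (simp add: mdeg_UNIV poly_mapping_eq_iff fun_eq_iff)
  qed
  then show "Poly_Mapping.lookup p m = Poly_Mapping.lookup (cst (Poly_Mapping.lookup p 0)) m"
    by (cases "m = 0") (auto simp: cst_def lookup_single when_def)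
qed

lemma hcomp_decomp:
  fixes p :: "('v, 'k::comm_ring_1) mpoly"
  shows "p = (\<Sum>d\<in>(\<lambda>m. int (mdeg m)) ` Poly_Mapping.keys p. hcomp d p)"
  by (intro poly_mapping_eqI) (auto simp: lookup_sum lookup_hcomp sum.delta in_keys_iff)

text \<open>Homogeneous generators make the ideal graded: a component of c * x is a component of c
  times x.\<close>

lemma hcomp_in_span:
  fixes p :: "('v::finite, 'k::comm_ring_1) mpoly"
  assumes "p \<in> idl.span X" "\<forall>x\<in>X. \<exists>d. hom d x"
  shows "hcomp d p \<in> idl.span X"
  using assms(1)
proof (induction rule: idl.span_induct_alt)
  case base
  show ?case by (simp add: idl.span_zero)
next
  case (step c x y)
  then obtain \<delta> where \<delta>: "hom \<delta> x"
    using assms(2) by blast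
  have "hcomp d (c * x) = hcomp (d - \<delta>) c * x"
    using hcomp_mult[OF \<delta>, of d c] by (simp add: mult.commute)
  then show ?case
    using step by (simp add: hcomp_add idl.span_add idl.span_base idl.span_scale)
qed

subsection \<open>Variables and linear forms\<close>

lemma lookup_mult_single:
  fixes h :: "('v, 'k::comm_ring_1) mpoly"
  shows "Poly_Mapping.lookup (h * Poly_Mapping.single k 1) (m + k) = Poly_Mapping.lookup h m"
proof -
  have "h * Poly_Mapping.single k 1
      = (\<Sum>m'\<in>Poly_Mapping.keys h. Poly_Mapping.single (m' + k) (Poly_Mapping.lookup h m'))"
    by (subst mpoly_sum[of h]) (simp add: sum_distrib_right mult_single)
  then show ?thesis
    by (auto simp: lookup_sum lookup_single when_def in_keys_iff sum.delta')
qed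

lemma hom_var [simp]: "hom 1 (var v :: ('v, 'k::comm_ring_1) mpoly)"
  by (simp add: hom_def var_def mdeg_def)

lemma linform_sum: "linform c = (\<Sum>v\<in>UNIV. cst (c v) * var v)"
  by (simp add: linform_def cst_def)

lemma hom_linform [simp]: "hom 1 (linform c)"
  unfolding linform_sum by (intro hom_sum hom_cst_mult) simp

lemma lookup_linform:
  fixes c :: "'v::finite \<Rightarrow> 'k::comm_ring_1"
  shows "Poly_Mapping.lookup (linform c) (Poly_Mapping.single v 1) = c v"
proof -
  have *: "(Poly_Mapping.single u (1::nat) = Poly_Mapping.single v 1) = (u = v)" for u v :: 'v
    by (metis lookup_single_eq lookup_single_not_eq zero_neq_one)
  show ?thesis
    unfolding linform_def var_def mult_single lookup_sum lookup_single when_def add_0 *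
    by (simp add: sum.delta del: One_nat_def)
qed

lemma mdeg_eq_1:
  assumes "mdeg (m :: 'v::finite \<Rightarrow>\<^sub>0 nat) = 1"
  obtains v where "m = Poly_Mapping.single v 1"
proof -
  obtain v where v: "Poly_Mapping.lookup m v \<noteq> 0"
    using assms by (metis mdeg_UNIV sum.neutral zero_neq_one)
  have "(\<Sum>u\<in>UNIV. Poly_Mapping.lookup m u) = Poly_Mapping.lookup m v + (\<Sum>u\<in>UNIV - {v}. Poly_Mapping.lookup m u)"
    by (simp add: sum.remove)
  then have "Poly_Mapping.lookup m v = 1" "\<forall>u\<in>UNIV - {v}. Poly_Mapping.lookup m u = 0"
    using assms v unfolding mdeg_UNIV sum_eq_0_iff[OF finite_Diff[OF finite], symmetric]
    by linarith+
  then have "m = Poly_Mapping.single v 1"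
    by (intro poly_mapping_eqI) (auto simp: lookup_single when_def)
  then show ?thesis by (rule that)
qed

lemma hom_1_linform:
  fixes p :: "('v::finite, 'k::comm_ring_1) mpoly"
  assumes "hom 1 p"
  shows "p = linform (\<lambda>v. Poly_Mapping.lookup p (Poly_Mapping.single v 1))"
proof (intro poly_mapping_eqI)
  fix m
  show "Poly_Mapping.lookup p m = Poly_Mapping.lookup (linform (\<lambda>v. Poly_Mapping.lookup p (Poly_Mapping.single v 1))) m"
  proof (cases "mdeg m = 1")
    case True
    then obtain v where "m = Poly_Mapping.single v 1" by (rule mdeg_eq_1)
    then show ?thesis by (simp only: lookup_linform)
  next
    case False
    then have "int (mdeg m) \<noteq> 1" by simp
    then have "m \<notin> Poly_Mapping.keys p" "m \<notin> Poly_Mapping.keys (linform (\<lambda>v. Poly_Mapping.lookup p (Poly_Mapping.single v 1)))"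
      using assms hom_linform unfolding hom_def by blast+
    then show ?thesis by (simp add: in_keys_iff)
  qed
qed

lemma linform_add: "linform (\<lambda>v. a v + b v) = linform a + linform b"
  by (simp add: linform_sum cst_add distrib_right sum.distrib)

lemma linform_scale: "linform (\<lambda>v. s * a v) = cst s * linform a"
  by (simp add: linform_sum cst_mult sum_distrib_left mult.assoc)

lemma linform_0 [simp]: "linform (\<lambda>v. 0) = 0"
  by (simp add: linform_sum)

lemma linform_eq_0_iff: "linform c = 0 \<longleftrightarrow> (\<forall>v. c v = 0)"
proof
  show "\<forall>v. c v = 0" if "linform c = 0"
    using lookup_linform[of c] that by simp
  show "linform c = 0" if "\<forall>v. c v = 0"
    using that by (simp add: linform_sum)
qed

lemma linform_axis:
  fixes v :: "'v::finite"
  shows "linform (\<lambda>u. if u = v then 1 else 0) = (var v :: ('v, 'k::comm_ring_1) mpoly)"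
proof -
  have "(\<Sum>u\<in>UNIV. cst (if u = v then 1 else 0) * var u) = (\<Sum>u\<in>UNIV. if u = v then var u else 0 :: ('v, 'k) mpoly)"
    by (intro sum.cong) auto
  then show ?thesis by (simp add: linform_sum)
qed

lemma span_var:
  "idl.span (var ` X) = {p :: ('v::finite, 'k::comm_ring_1) mpoly.
     \<forall>m\<in>Poly_Mapping.keys p. \<exists>u\<in>X. Poly_Mapping.lookup m u > 0}" (is "_ = ?M")
proof
  show "idl.span (var ` X) \<subseteq> ?M"
  proof
    fix p assume "p \<in> idl.span (var ` X :: ('v, 'k) mpoly set)"
    then show "p \<in> ?M"
    proof (induction rule: idl.span_induct_alt)
      case base
      show ?case by simp
    next
      case (step c x y)
      then obtain u where u: "u \<in> X" "x = var u" by auto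
      have "\<exists>u\<in>X. Poly_Mapping.lookup m u > 0" if "m \<in> Poly_Mapping.keys (c * x)" for m
      proof -
        have "m \<in> {a + b |a b. a \<in> Poly_Mapping.keys c \<and> b \<in> Poly_Mapping.keys x}"
          using that keys_mult by blast
        then obtain a where "m = a + Poly_Mapping.single u 1"
          by (auto simp: u var_def)
        then show ?thesis using u by (auto simp: lookup_add intro!: bexI[of _ u])
      qed
      then show ?case
        using step.IH keys_add[of "c * x" y] by blast
    qed
  qed
  show "?M \<subseteq> idl.span (var ` X)"
  proof
    fix p assume p: "p \<in> ?M"
    have "Poly_Mapping.single m (Poly_Mapping.lookup p m) \<in> idl.span (var ` X)"
      if m: "m \<in> Poly_Mapping.keys p" for m
    proof -
      obtain u where u: "u \<in> X" "Poly_Mapping.lookup m u > 0"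
        using p m by auto
      have "(m - Poly_Mapping.single u 1) + Poly_Mapping.single u 1 = m"
        using u(2) by (intro poly_mapping_eqI) (auto simp: lookup_add lookup_minus lookup_single when_def)
      then have "Poly_Mapping.single m (Poly_Mapping.lookup p m)
          = Poly_Mapping.single (m - Poly_Mapping.single u 1) (Poly_Mapping.lookup p m) * var u"
        by (simp only: var_def mult_single mult_1_right)
      then show ?thesis
        using u(1) by (simp add: idl.span_base idl.span_scale)
    qed
    then show "p \<in> idl.span (var ` X)"
      by (subst mpoly_sum[of p]) (rule idl.span_sum)
  qed
qed

text \<open>Multiplication by \<open>var v\<close> shifts only the exponent of v, so a variable of X
  dividing the shifted monomial already divided the original one.\<close>

lemma var_nzd_mod_vars:
  fixes h :: "('v::finite, 'k::comm_ring_1) mpoly"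
  assumes "v \<notin> X" "h * var v \<in> idl.span (var ` X)"
  shows "h \<in> idl.span (var ` X)"
proof -
  have "\<exists>u\<in>X. Poly_Mapping.lookup m u > 0" if "m \<in> Poly_Mapping.keys h" for m
  proof -
    have "m + Poly_Mapping.single v 1 \<in> Poly_Mapping.keys (h * var v)"
      using that by (simp add: var_def in_keys_iff lookup_mult_single del: One_nat_def)
    then obtain u where "u \<in> X" "Poly_Mapping.lookup (m + Poly_Mapping.single v 1) u > 0"
      using assms(2) unfolding span_var by blast
    then show ?thesis
      using assms(1) by (auto simp: lookup_add lookup_single when_def split: if_splits)
  qed
  then show ?thesis by (simp add: span_var)
qed

subsection \<open>Koszul cochains\<close>

text \<open>A Koszul cochain of degree i on f 0, ..., f (m - 1) is a function on the subsets of {..<m}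
of cardinality i; its values on other sets are irrelevant.\<close>

definition ksgn :: "nat \<Rightarrow> nat set \<Rightarrow> 'a::comm_ring_1" where
  "ksgn j A = (- 1) ^ card {a \<in> A. a < j}"

definition kosz :: "(nat \<Rightarrow> 'a::comm_ring_1) \<Rightarrow> (nat set \<Rightarrow> 'a) \<Rightarrow> nat set \<Rightarrow> 'a" where
  "kosz f \<eta> A = (\<Sum>j\<in>A. ksgn j A * f j * \<eta> (A - {j}))"

lemma ksgn_square [simp]: "ksgn j A * ksgn j A = (1 :: 'a::comm_ring_1)"
  by (simp add: ksgn_def flip: power_add mult_2)

lemma ksgn_square_left [simp]: "ksgn j A * (ksgn j A * x) = (x :: 'a::comm_ring_1)"
  by (simp flip: mult.assoc)

lemma ksgn_diff_less: "i < j \<Longrightarrow> ksgn i (A - {j}) = ksgn i A"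
  unfolding ksgn_def by (rule arg_cong[where f = "\<lambda>B. (- 1) ^ card B"]) auto

lemma ksgn_diff_greater:
  assumes "finite A" "i \<in> A" "i < j"
  shows "ksgn j (A - {i}) = - (ksgn j A :: 'a::comm_ring_1)"
proof -
  have "{a \<in> A. a < j} = insert i {a \<in> A - {i}. a < j}"
    using assms by auto
  moreover have "card \<dots> = Suc (card {a \<in> A - {i}. a < j})"
    using assms(1) by (intro card_insert_disjoint) auto
  ultimately show ?thesis
    by (simp add: ksgn_def)
qed

lemma kosz_cong:
  "(\<And>j. j \<in> A \<Longrightarrow> \<eta> (A - {j}) = \<theta> (A - {j})) \<Longrightarrow> kosz f \<eta> A = kosz f \<theta> A"
  by (simp add: kosz_def)

lemma kosz_empty [simp]: "kosz f \<eta> {} = 0"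
  by (simp add: kosz_def)

lemma kosz_zero [simp]: "kosz f (\<lambda>B. 0) A = 0"
  by (simp add: kosz_def)

lemma kosz_add: "kosz f (\<lambda>B. \<eta> B + \<theta> B) A = kosz f \<eta> A + kosz f \<theta> A"
  by (simp add: kosz_def distrib_left sum.distrib)

lemma kosz_diff: "kosz f (\<lambda>B. \<eta> B - \<theta> B) A = kosz f \<eta> A - kosz f \<theta> A"
  by (simp add: kosz_def right_diff_distrib sum_subtractf)

lemma kosz_scale: "kosz f (\<lambda>B. c * \<eta> B) A = c * kosz f \<eta> A"
  by (simp add: kosz_def sum_distrib_left mult_ac)

text \<open>The two orders of removing i < j cancel: removing i shifts the position of j by one,
  while removing j leaves that of i unchanged.\<close>

lemma kosz_kosz:
  assumes "finite A"
  shows "kosz f (kosz f \<eta>) A = (0 :: 'a::comm_ring_1)"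
proof -
  define T :: "nat \<Rightarrow> nat \<Rightarrow> 'a" where
    "T j i = ksgn j A * f j * (ksgn i (A - {j}) * f i * \<eta> (A - {j} - {i}))" for j i
  have swap: "T j i = - T i j" if "i \<in> A" "j \<in> A" "i < j" for i j
  proof -
    have "A - {j} - {i} = A - {i} - {j}" by auto
    then show ?thesis
      using assms that unfolding T_def
      by (simp add: ksgn_diff_less ksgn_diff_greater)
  qed
  have "kosz f (kosz f \<eta>) A = (\<Sum>j\<in>A. \<Sum>i\<in>A - {j}. T j i)"
    by (simp add: kosz_def T_def sum_distrib_left)
  also have "\<dots> = (\<Sum>j\<in>A. (\<Sum>i\<in>A. if i < j then T j i else 0) + (\<Sum>i\<in>A. if j < i then T j i else 0))"
  proof (intro sum.cong refl)
    fix j assume "j \<in> A"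
    have "(\<Sum>i\<in>A. if i < j then T j i else 0) + (\<Sum>i\<in>A. if j < i then T j i else 0)
        = (\<Sum>i\<in>A. if i \<noteq> j then T j i else 0)"
      unfolding sum.distrib[symmetric] by (intro sum.cong refl) auto
    also have "\<dots> = (\<Sum>i\<in>A - {j}. T j i)"
      using assms by (intro sum.mono_neutral_cong_right) auto
    finally show "(\<Sum>i\<in>A - {j}. T j i)
        = (\<Sum>i\<in>A. if i < j then T j i else 0) + (\<Sum>i\<in>A. if j < i then T j i else 0)" ..
  qed
  also have "\<dots> = (\<Sum>j\<in>A. \<Sum>i\<in>A. if i < j then T j i else 0) + (\<Sum>i\<in>A. \<Sum>j\<in>A. if i < j then T i j else 0)"
    by (simp only: sum.distrib)
  also have "(\<Sum>i\<in>A. \<Sum>j\<in>A. if i < j then T i j else 0) = (\<Sum>j\<in>A. \<Sum>i\<in>A. if i < j then T i j else 0)"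
    by (rule sum.swap)
  also have "(\<Sum>j\<in>A. \<Sum>i\<in>A. if i < j then T j i else 0) + \<dots> = (\<Sum>j\<in>A. \<Sum>i\<in>A. 0)"
    unfolding sum.distrib[symmetric] by (intro sum.cong refl) (use swap in auto)
  finally show ?thesis by simp
qed

lemma kosz_commute:
  "kosz g (\<lambda>B'. kosz f (\<lambda>A'. \<phi> A' B') A) B = kosz f (\<lambda>A'. kosz g (\<phi> A') B) A"
  unfolding kosz_def sum_distrib_left by (subst sum.swap) (intro sum.cong refl, simp add: mult_ac)

text \<open>Adding a generator forms the mapping cone of multiplication by f m; this is its
  differential on sets that contain m.\<close>

lemma kosz_insert_max:
  assumes "A \<subseteq> {..<m}"
  shows "kosz f \<eta> (insert m A) = kosz f (\<lambda>B. \<eta> (insert m B)) A + (- 1) ^ card A * f m * \<eta> A"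
proof -
  have fin: "finite A" "m \<notin> A" using assms finite_subset by auto
  have "{a \<in> insert m A. a < m} = A" using assms by auto
  then have m: "ksgn m (insert m A) = (- 1) ^ card A" by (simp add: ksgn_def)
  have "ksgn j (insert m A) * f j * \<eta> (insert m A - {j}) = ksgn j A * f j * \<eta> (insert m (A - {j}))"
    if "j \<in> A" for j
  proof -
    have "{a \<in> insert m A. a < j} = {a \<in> A. a < j}" "insert m A - {j} = insert m (A - {j})"
      using assms that by auto
    then show ?thesis by (simp add: ksgn_def)
  qed
  moreover have "insert m A - {m} = A" using fin by auto
  ultimately show ?thesis
    using fin by (simp add: kosz_def m add.commute cong: sum.cong)
qed

lemma idl_span_image_lessThan:
  "idl.span (f ` {..<m::nat}) = {\<Sum>j<m. c j * f j | c. True}"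
proof (induction m)
  case 0
  show ?case by simp
next
  case (Suc m)
  show ?case
  proof (intro set_eqI iffI)
    fix x assume "x \<in> idl.span (f ` {..<Suc m})"
    then obtain k where "x - k * f m \<in> idl.span (f ` {..<m})"
      by (auto simp: lessThan_Suc idl.span_breakdown_eq)
    then obtain c where "x - k * f m = (\<Sum>j<m. c j * f j)"
      unfolding Suc.IH by blast
    then have "x = (\<Sum>j<Suc m. (c(m := k)) j * f j)"
      by (simp add: diff_eq_eq)
    then show "x \<in> {\<Sum>j<Suc m. c j * f j | c. True}" by blast
  next
    fix x assume "x \<in> {\<Sum>j<Suc m. c j * f j | c. True}"
    then obtain c where "x = (\<Sum>j<Suc m. c j * f j)" by blast
    then show "x \<in> idl.span (f ` {..<Suc m})"
      by (simp only:) (intro idl.span_sum idl.span_scale idl.span_base imageI)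
  qed
qed

text \<open>The top cohomology of the Koszul complex is the ring modulo (f): cochains of degree m -
  1 live on the complements of single indices.\<close>

lemma in_idl_iff_kosz:
  "x \<in> idl.span (f ` {..<m}) \<longleftrightarrow> (\<exists>\<theta>. x = kosz f \<theta> {..<m})"
proof
  assume "x \<in> idl.span (f ` {..<m})"
  then obtain c where c: "x = (\<Sum>j<m. c j * f j)"
    unfolding idl_span_image_lessThan by blast
  \<comment> \<open>Only complements of a single j matter; there the sum has one term, and its sign
    cancels the one in \<open>kosz\<close>.\<close>
  define \<theta> where "\<theta> B = (\<Sum>j\<in>{..<m} - B. ksgn j {..<m} * c j)" for B
  have "\<theta> ({..<m} - {j}) = ksgn j {..<m} * c j" if "j < m" for j
  proof -
    have "{..<m} - ({..<m} - {j}) = {j}" using that by auto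
    then show ?thesis by (simp add: \<theta>_def)
  qed
  then have "kosz f \<theta> {..<m} = (\<Sum>j<m. ksgn j {..<m} * f j * (ksgn j {..<m} * c j))"
    by (simp add: kosz_def)
  also have "\<dots> = x"
    unfolding c by (intro sum.cong refl) (simp add: mult_ac)
  finally show "\<exists>\<theta>. x = kosz f \<theta> {..<m}" by metis
next
  assume "\<exists>\<theta>. x = kosz f \<theta> {..<m}"
  then obtain \<theta> where "x = (\<Sum>j<m. (ksgn j {..<m} * \<theta> ({..<m} - {j})) * f j)"
    by (auto simp: kosz_def mult_ac)
  then show "x \<in> idl.span (f ` {..<m})"
    by (simp only:) (intro idl.span_sum idl.span_scale idl.span_base imageI)
qed

definition kreg :: "(nat \<Rightarrow> 'a::comm_ring_1) \<Rightarrow> nat \<Rightarrow> bool" where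
  "kreg f m \<longleftrightarrow> (\<forall>i<m. \<forall>h. h * f i \<in> idl.span (f ` {..<i}) \<longrightarrow> h \<in> idl.span (f ` {..<i}))"

text \<open>Below the top degree m, cohomology vanishes for a regular sequence. Induction on m
  treats separately the values on sets without m and on sets containing m, as in the long exact
  sequence of the cone.\<close>

theorem kosz_exact:
  fixes f :: "nat \<Rightarrow> 'a::comm_ring_1"
  assumes "kreg f m" "i < m" "\<And>A. A \<subseteq> {..<m} \<Longrightarrow> card A = Suc i \<Longrightarrow> kosz f \<eta> A = 0"
  shows "\<exists>\<theta>. \<forall>A. A \<subseteq> {..<m} \<and> card A = i \<longrightarrow> \<eta> A = kosz f \<theta> A"
  using assms
proof (induction m arbitrary: i \<eta>)
  case 0
  from \<open>i < 0\<close> show ?case by simp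
next
  case (Suc m)
  have reg: "kreg f m" using Suc.prems(1) less_SucI unfolding kreg_def by blast
  have nzd: "h \<in> idl.span (f ` {..<m})" if "h * f m \<in> idl.span (f ` {..<m})" for h
    using Suc.prems(1) that unfolding kreg_def by blast
  have sub: "A \<subseteq> {..<Suc m}" if "A \<subseteq> {..<m}" for A
    using that by auto
  have fin: "finite A" if "A \<subseteq> {..<m}" for A
    using that finite_subset by auto
  have nin: "m \<notin> A" if "A \<subseteq> {..<m}" for A
    using that by auto
  have ins: "kosz f (\<lambda>B. \<eta> (insert m B)) A + (- 1) ^ card A * f m * \<eta> A = 0"
    if "A \<subseteq> {..<m}" "card A = i" for A
  proof -
    have "insert m A \<subseteq> {..<Suc m}" "card (insert m A) = Suc i"
      using that fin nin by auto
    then have "kosz f \<eta> (insert m A) = 0"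
      by (rule Suc.prems(3))
    then show ?thesis
      unfolding kosz_insert_max[OF that(1)] .
  qed
  have "\<exists>\<theta>. \<forall>A. A \<subseteq> {..<m} \<and> card A = i \<longrightarrow> \<eta> A = kosz f \<theta> A"
  proof (cases "i < m")
    case True
    then show ?thesis
      using Suc.IH[OF reg True] Suc.prems(3) sub by blast
  next
    case False
    then have i: "i = m" using Suc.prems(2) by simp
    \<comment> \<open>In degree m the shorter complex does have cohomology, the ring modulo f 0,
      ..., f (m - 1); this is where f m must be a nonzerodivisor.\<close>
    have "\<eta> {..<m} * f m = - ((- 1) ^ m * kosz f (\<lambda>B. \<eta> (insert m B)) {..<m})"
    proof -
      define s :: 'a where "s = (- 1) ^ m"
      have s: "s * s = 1" by (simp add: s_def flip: power_add mult_2)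
      have "kosz f (\<lambda>B. \<eta> (insert m B)) {..<m} = - (s * f m * \<eta> {..<m})"
        using ins[of "{..<m}"] i by (simp add: eq_neg_iff_add_eq_0 s_def)
      then have "s * kosz f (\<lambda>B. \<eta> (insert m B)) {..<m} = - ((s * s) * (f m * \<eta> {..<m}))"
        by (simp only: mult_minus_right mult.assoc)
      then show ?thesis by (simp add: s mult.commute flip: s_def)
    qed
    moreover have "kosz f (\<lambda>B. \<eta> (insert m B)) {..<m} \<in> idl.span (f ` {..<m})"
      unfolding in_idl_iff_kosz by blast
    ultimately have "\<eta> {..<m} * f m \<in> idl.span (f ` {..<m})"
      by (simp add: idl.span_neg idl.span_scale)
    then have "\<eta> {..<m} \<in> idl.span (f ` {..<m})" by (rule nzd)
    then obtain \<theta> where "\<eta> {..<m} = kosz f \<theta> {..<m}"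
      unfolding in_idl_iff_kosz by blast
    moreover have "A = {..<m}" if "A \<subseteq> {..<m}" "card A = i" for A
      using that i by (simp add: card_subset_eq)
    ultimately show ?thesis by blast
  qed
  then obtain \<theta>1 where \<theta>1: "\<And>A. A \<subseteq> {..<m} \<Longrightarrow> card A = i \<Longrightarrow> \<eta> A = kosz f \<theta>1 A"
    by blast
  show ?case
  proof (cases i)
    case 0
    have "\<eta> A = kosz f \<theta>1 A" if "A \<subseteq> {..<Suc m}" "card A = i" for A
    proof -
      have "A = {}" using that 0 finite_subset[OF that(1)] by simp
      then show ?thesis using \<theta>1[of A] 0 by simp
    qed
    then show ?thesis by blast
  next
    case (Suc i')
    \<comment> \<open>What remains on sets containing m once \<theta>1 is fixed on the others; it is
      a cocycle of degree one lower.\<close>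
    define \<zeta> where "\<zeta> B = \<eta> (insert m B) - ((- 1) ^ i' * f m) * \<theta>1 B" for B
    have "kosz f \<zeta> B = 0" if "B \<subseteq> {..<m}" "card B = Suc i'" for B
    proof -
      have "kosz f \<zeta> B = kosz f (\<lambda>B. \<eta> (insert m B)) B - ((- 1) ^ i' * f m) * kosz f \<theta>1 B"
        unfolding \<zeta>_def kosz_diff kosz_scale ..
      also have "\<dots> = 0"
        using ins[OF that(1)] that Suc \<theta>1[OF that(1)] by (simp add: mult_ac)
      finally show ?thesis .
    qed
    then obtain \<theta>2 where \<theta>2: "\<And>B. B \<subseteq> {..<m} \<Longrightarrow> card B = i' \<Longrightarrow> \<zeta> B = kosz f \<theta>2 B"
      using Suc.IH[OF reg, of i' \<zeta>] Suc Suc.prems(2) by auto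
    define \<theta> where "\<theta> A = (if m \<in> A then \<theta>2 (A - {m}) else \<theta>1 A)" for A
    have "\<eta> A = kosz f \<theta> A" if A: "A \<subseteq> {..<Suc m}" "card A = i" for A
    proof (cases "m \<in> A")
      case False
      then have "A \<subseteq> {..<m}" using A by (auto simp: less_Suc_eq)
      then have "\<eta> A = kosz f \<theta>1 A" using A \<theta>1 by blast
      also have "\<dots> = kosz f \<theta> A"
        using False by (intro kosz_cong) (simp add: \<theta>_def)
      finally show ?thesis .
    next
      case True
      define B where "B = A - {m}"
      have B: "B \<subseteq> {..<m}" "A = insert m B" "m \<notin> B"
        using A True by (auto simp: B_def less_Suc_eq)
      then have cB: "card B = i'"
        using A Suc fin[OF B(1)] by simp
      have "kosz f \<theta> A = kosz f (\<lambda>C. \<theta> (insert m C)) B + (- 1) ^ card B * f m * \<theta> B"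
        unfolding B(2) by (rule kosz_insert_max[OF B(1)])
      also have "kosz f (\<lambda>C. \<theta> (insert m C)) B = kosz f \<theta>2 B"
        using B(3) by (intro kosz_cong) (simp add: \<theta>_def)
      also have "\<dots> = \<zeta> B" using \<theta>2[OF B(1) cB] ..
      also have "\<theta> B = \<theta>1 B" using B(3) by (simp add: \<theta>_def)
      finally show ?thesis by (simp add: \<zeta>_def cB B(2))
    qed
    then show ?thesis by blast
  qed
qed

subsection \<open>Lifting a multiplication map to Koszul complexes\<close>

text \<open>A chain map from the Koszul complex of f to that of g. A labels a basis element of the
  source and B the complement of one of the target, so card A is the homological degree and card B
  is p - card A. With complements both differentials take the form \<open>kosz\<close>, the signs of
  the duality being absorbed in \<phi>, and degree zero is the single element \<phi> {}
  {..<p}.\<close>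

definition kosz_map :: "(nat \<Rightarrow> 'a::comm_ring_1) \<Rightarrow> nat \<Rightarrow> (nat \<Rightarrow> 'a) \<Rightarrow> nat \<Rightarrow> (nat set \<Rightarrow> nat set \<Rightarrow> 'a) \<Rightarrow> bool" where
  "kosz_map f m g p \<phi> \<longleftrightarrow> (\<forall>A B. A \<subseteq> {..<m} \<and> B \<subseteq> {..<p} \<and> card A + card B = Suc p \<longrightarrow>
     kosz f (\<lambda>A'. \<phi> A' B) A = kosz g (\<phi> A) B)"

lemma kosz_map_comb:
  assumes "kosz_map f m g p \<phi>" "kosz_map f m g p \<psi>"
  shows "kosz_map f m g p (\<lambda>A B. a * \<phi> A B + b * \<psi> A B)"
  using assms unfolding kosz_map_def by (simp add: kosz_add kosz_scale)

text \<open>The lift phi is null-homotopic below the degree j in which it vanishes; h and h' are the parts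
of a homotopy constructed downwards from j.\<close>

lemma kosz_map_descent:
  fixes f g :: "nat \<Rightarrow> 'a::comm_ring_1"
  assumes f: "kreg f m" and \<phi>: "kosz_map f m g p \<phi>" and j: "j \<le> m"
    and zero: "\<And>A B. A \<subseteq> {..<m} \<Longrightarrow> B \<subseteq> {..<p} \<Longrightarrow> card A = j \<Longrightarrow> card A + card B = p \<Longrightarrow> \<phi> A B = 0"
  shows "\<phi> {} {..<p} \<in> idl.span (g ` {..<p})"
proof -
  define Q where "Q i \<longleftrightarrow> (\<exists>h h'. \<forall>A B. A \<subseteq> {..<m} \<and> B \<subseteq> {..<p} \<and> card A = i \<and> card A + card B = p \<longrightarrow>
     \<phi> A B = kosz g (h A) B + kosz f (\<lambda>A'. h' A' B) A)" for i
  have finm: "finite A" if "A \<subseteq> {..<m}" for A using that finite_subset by auto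
  have finp: "finite B" if "B \<subseteq> {..<p}" for B using that finite_subset by auto
  have "Q j"
    unfolding Q_def using zero by (intro exI[of _ "\<lambda>_ _. 0"]) simp
  moreover have step: "Q i" if Q: "Q (Suc i)" and "i < m" for i
  proof -
    obtain h h' where "\<forall>A B. A \<subseteq> {..<m} \<and> B \<subseteq> {..<p} \<and> card A = Suc i \<and> card A + card B = p \<longrightarrow>
       \<phi> A B = kosz g (h A) B + kosz f (\<lambda>A'. h' A' B) A"
      using Q unfolding Q_def by (elim exE)
    then have h: "\<phi> A B = kosz g (h A) B + kosz f (\<lambda>A'. h' A' B) A"
      if "A \<subseteq> {..<m}" "B \<subseteq> {..<p}" "card A = Suc i" "card A + card B = p" for A B
      using that by blast
    \<comment> \<open>The old h' becomes the new h: for fixed B, the difference \<phi> A B - kosz g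
      (h' A) B is a cocycle in A, and exactness for f supplies the next part.\<close>
    have "\<exists>\<theta>. \<forall>A. A \<subseteq> {..<m} \<and> card A = i \<longrightarrow> \<phi> A B - kosz g (h' A) B = kosz f \<theta> A"
      if B: "B \<subseteq> {..<p}" "i + card B = p" for B
    proof (rule kosz_exact[OF f \<open>i < m\<close>])
      fix A assume A: "A \<subseteq> {..<m}" "card A = Suc i"
      have "kosz f (\<lambda>A. \<phi> A B) A = kosz g (\<phi> A) B"
        using \<phi> A B unfolding kosz_map_def by simp
      also have "\<dots> = kosz g (\<lambda>B. kosz g (h A) B + kosz f (\<lambda>A'. h' A' B) A) B"
      proof (rule kosz_cong)
        fix j assume "j \<in> B"
        then have "Suc (card (B - {j})) = card B"
          using finp[OF B(1)] by (metis card_Suc_Diff1)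
        then show "\<phi> A (B - {j}) = kosz g (h A) (B - {j}) + kosz f (\<lambda>A'. h' A' (B - {j})) A"
          using A B by (intro h) auto
      qed
      also have "\<dots> = kosz f (\<lambda>A'. kosz g (h' A') B) A"
        unfolding kosz_add kosz_kosz[OF finp[OF B(1)]] kosz_commute[of g f] by simp
      finally show "kosz f (\<lambda>A. \<phi> A B - kosz g (h' A) B) A = 0"
        by (simp add: kosz_diff)
    qed
    then have "\<forall>B. \<exists>\<theta>. B \<subseteq> {..<p} \<and> i + card B = p \<longrightarrow>
        (\<forall>A. A \<subseteq> {..<m} \<and> card A = i \<longrightarrow> \<phi> A B - kosz g (h' A) B = kosz f \<theta> A)"
      by blast
    then obtain \<theta> where \<theta>: "\<forall>B. B \<subseteq> {..<p} \<and> i + card B = p \<longrightarrow>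
        (\<forall>A. A \<subseteq> {..<m} \<and> card A = i \<longrightarrow> \<phi> A B - kosz g (h' A) B = kosz f (\<theta> B) A)"
      by (rule choice[THEN exE])
    have *: "\<phi> A B = kosz g (h' A) B + kosz f (\<lambda>A'. \<theta> B A') A"
      if "A \<subseteq> {..<m}" "B \<subseteq> {..<p}" "card A = i" "card A + card B = p" for A B
    proof -
      have "\<phi> A B - kosz g (h' A) B = kosz f (\<theta> B) A"
        using \<theta>[THEN spec, of B] that by blast
      then show ?thesis
        by (simp only: diff_eq_eq add.commute)
    qed
    show ?thesis
      unfolding Q_def
      by (intro exI[of _ h'] exI[of _ "\<lambda>A B. \<theta> B A"] allI impI, elim conjE) (rule *)
  qed
  have "Q k \<Longrightarrow> k \<le> m \<Longrightarrow> Q 0" for k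
  proof (induction k)
    case (Suc k)
    show ?case
      by (rule Suc.IH) (use step[OF Suc.prems(1)] Suc.prems(2) in linarith)+
  qed
  ultimately have "Q 0"
    using j by blast
  then obtain h h' where "\<forall>A B. A \<subseteq> {..<m} \<and> B \<subseteq> {..<p} \<and> card A = 0 \<and> card A + card B = p \<longrightarrow>
       \<phi> A B = kosz g (h A) B + kosz f (\<lambda>A'. h' A' B) A"
    unfolding Q_def by (elim exE)
  \<comment> \<open>At A = {} the f-part is an empty sum, so only a boundary for g remains.\<close>
  from this[THEN spec, of "{}", THEN spec, of "{..<p}"]
  have "\<phi> {} {..<p} = kosz g (h {}) {..<p} + kosz f (\<lambda>A'. h' A' {..<p}) {}"
    by (simp only: empty_subsetI subset_refl card.empty card_lessThan add_0)
  then have "\<phi> {} {..<p} = kosz g (h {}) {..<p}"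
    by (simp only: kosz_empty add_0_right)
  then show ?thesis
    unfolding in_idl_iff_kosz by blast
qed

lemma hom_ksgn: "hom 0 (ksgn j A :: ('v::finite, 'k::comm_ring_1) mpoly)"
  unfolding ksgn_def using hom_power[OF hom_uminus[OF hom_1]] by force

lemma hcomp_kosz:
  fixes f :: "nat \<Rightarrow> ('v::finite, 'k::comm_ring_1) mpoly"
  assumes "\<And>j. j \<in> A \<Longrightarrow> hom \<delta> (f j)"
  shows "hcomp d (kosz f \<theta> A) = kosz f (\<lambda>B. hcomp (d - \<delta>) (\<theta> B)) A"
proof -
  have "hcomp d (ksgn j A * f j * \<theta> (A - {j})) = ksgn j A * f j * hcomp (d - \<delta>) (\<theta> (A - {j}))"
    if "j \<in> A" for j
    using hom_mult[OF hom_ksgn assms[OF that], of j A] by (intro hcomp_mult) simp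
  then show ?thesis
    unfolding kosz_def hcomp_sum by simp
qed

text \<open>Comparison of a complex of free modules with a resolution: z induces a map from the ring
  modulo (f) to the ring modulo (g), and each further component is lifted by exactness for g. A step
  multiplies by a form of degree \<alpha> and divides by one of degree \<beta>, which accounts for
  the degrees.\<close>

lemma kosz_map_exists:
  fixes f g :: "nat \<Rightarrow> ('v::finite, 'k::comm_ring_1) mpoly"
  assumes g: "kreg g p" and homf: "\<And>j. j < m \<Longrightarrow> hom \<alpha> (f j)" and homg: "\<And>j. j < p \<Longrightarrow> hom \<beta> (g j)"
    and z: "hom e z" "\<And>j. j < m \<Longrightarrow> z * f j \<in> idl.span (g ` {..<p})"
  shows "\<exists>\<phi>. kosz_map f m g p \<phi> \<and> \<phi> {} {..<p} = z \<and>
    (\<forall>A B. A \<subseteq> {..<m} \<and> B \<subseteq> {..<p} \<and> card A + card B = p \<longrightarrow>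
      hom (e + int (card A) * (\<alpha> - \<beta>)) (\<phi> A B))"
proof -
  have finm: "finite A" if "A \<subseteq> {..<m}" for A using that finite_subset by auto
  have finp: "finite B" if "B \<subseteq> {..<p}" for B using that finite_subset by auto
  define good where "good n \<phi> \<longleftrightarrow> \<phi> {} {..<p} = z \<and>
     (\<forall>A B. A \<subseteq> {..<m} \<and> B \<subseteq> {..<p} \<and> card A + card B = Suc p \<and> card A \<le> n \<longrightarrow>
        kosz f (\<lambda>A'. \<phi> A' B) A = kosz g (\<phi> A) B) \<and>
     (\<forall>A B. A \<subseteq> {..<m} \<and> B \<subseteq> {..<p} \<and> card A + card B = p \<and> card A \<le> n \<longrightarrow>
        hom (e + int (card A) * (\<alpha> - \<beta>)) (\<phi> A B))" for n and \<phi> :: "nat set \<Rightarrow> nat set \<Rightarrow> ('v, 'k) mpoly"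
  have "\<exists>\<phi>. good n \<phi>" for n
  proof (induction n)
    case 0
    have *: False if "B \<subseteq> {..<p}" "card A + card B = Suc p" "card A \<le> 0" for A B :: "nat set"
    proof -
      have "card B \<le> card {..<p}" using that(1) by (intro card_mono) simp_all
      then show False using that(2,3) by (simp only: card_lessThan)
    qed
    have "good 0 (\<lambda>_ _. z)"
      unfolding good_def
    proof (intro conjI allI impI)
      fix A B assume "A \<subseteq> {..<m} \<and> B \<subseteq> {..<p} \<and> card A + card B = Suc p \<and> card A \<le> 0"
      then show "kosz f (\<lambda>A'. z) A = kosz g (\<lambda>B. z) B"
        using *[of B A] by blast
    next
      fix A B assume "A \<subseteq> {..<m} \<and> B \<subseteq> {..<p} \<and> card A + card B = p \<and> card A \<le> 0"
      then have "card A = 0" by (elim conjE) simp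
      then show "hom (e + int (card A) * (\<alpha> - \<beta>)) z"
        using z(1) by simp
    qed (rule refl)
    then show ?case by (intro exI[of _ "\<lambda>_ _. z"])
  next
    case (Suc n)
    then obtain \<phi> where \<phi>: "good n \<phi>" by (rule exE)
    have \<phi>0: "\<phi> {} {..<p} = z"
      using \<phi> unfolding good_def by (elim conjE)
    have \<phi>1: "kosz f (\<lambda>A'. \<phi> A' B) A = kosz g (\<phi> A) B"
      if "A \<subseteq> {..<m}" "B \<subseteq> {..<p}" "card A + card B = Suc p" "card A \<le> n" for A B
      by (rule \<phi>[unfolded good_def, THEN conjunct2, THEN conjunct1, rule_format]) (intro conjI that)
    have \<phi>2: "hom (e + int (card A) * (\<alpha> - \<beta>)) (\<phi> A B)"
      if "A \<subseteq> {..<m}" "B \<subseteq> {..<p}" "card A + card B = p" "card A \<le> n" for A B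
      by (rule \<phi>[unfolded good_def, THEN conjunct2, THEN conjunct2, rule_format]) (intro conjI that)
    let ?d = "e + int (Suc n) * (\<alpha> - \<beta>)"
    have lift: "\<exists>\<theta>. (\<forall>B. B \<subseteq> {..<p} \<and> n + card B = p \<longrightarrow> kosz f (\<lambda>A'. \<phi> A' B) A = kosz g \<theta> B) \<and>
        (\<forall>B. hom ?d (\<theta> B))"
      if A: "A \<subseteq> {..<m}" "card A = Suc n" for A
    proof -
      have cA: "A - {j} \<subseteq> {..<m}" "card (A - {j}) = n" if "j \<in> A" for j
        using A that finm by auto
      \<comment> \<open>For n = 0 the obstruction lies in the top cohomology for g and dies because
        z * f j is in (g); for n > 0 it is a cocycle below the top degree.\<close>
      have "\<exists>\<theta>. \<forall>B. B \<subseteq> {..<p} \<and> n + card B = p \<longrightarrow> kosz f (\<lambda>A'. \<phi> A' B) A = kosz g \<theta> B"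
      proof (cases n)
        case 0
        then obtain j where j: "A = {j}"
          using A(2) by (auto simp: card_1_singleton_iff)
        then have "kosz f (\<lambda>A'. \<phi> A' {..<p}) A \<in> idl.span (g ` {..<p})"
          using idl.span_scale[OF z(2)[of j], of "ksgn j {j}"] A(1)
          by (simp add: kosz_def \<phi>0 mult_ac)
        then obtain \<theta> where "kosz f (\<lambda>A'. \<phi> A' {..<p}) A = kosz g \<theta> {..<p}"
          unfolding in_idl_iff_kosz by blast
        moreover have "B = {..<p}" if "B \<subseteq> {..<p}" "n + card B = p" for B
          using that 0 by (simp add: card_subset_eq)
        ultimately show ?thesis by blast
      next
        case (Suc n')
        show ?thesis
        proof (cases "n \<le> p")
          case False
          then show ?thesis by auto
        next
          case True
          have "\<exists>\<theta>. \<forall>B. B \<subseteq> {..<p} \<and> card B = p - n \<longrightarrow> kosz f (\<lambda>A'. \<phi> A' B) A = kosz g \<theta> B"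
          proof (rule kosz_exact[OF g])
            show "p - n < p" using True Suc by simp
            fix B assume B: "B \<subseteq> {..<p}" "card B = Suc (p - n)"
            have "kosz g (\<lambda>B. kosz f (\<lambda>A'. \<phi> A' B) A) B = kosz f (\<lambda>A'. kosz g (\<phi> A') B) A"
              by (rule kosz_commute)
            also have "\<dots> = kosz f (\<lambda>A'. kosz f (\<lambda>A''. \<phi> A'' B) A') A"
              using cA B True by (intro kosz_cong \<phi>1[symmetric]) simp_all
            also have "\<dots> = 0"
              using kosz_kosz[OF finm[OF A(1)]] .
            finally show "kosz g (\<lambda>B. kosz f (\<lambda>A'. \<phi> A' B) A) B = 0" .
          qed
          moreover have "card B = p - n" if "n + card B = p" for B :: "nat set"
            using that by simp
          ultimately show ?thesis by blast
        qed
      qed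
      then obtain \<theta> where \<theta>: "\<And>B. B \<subseteq> {..<p} \<Longrightarrow> n + card B = p \<Longrightarrow> kosz f (\<lambda>A'. \<phi> A' B) A = kosz g \<theta> B"
        by blast
      \<comment> \<open>Exactness gives some lift, not a homogeneous one; since the left side is
        homogeneous, the component of the right degree is a lift too.\<close>
      have "kosz f (\<lambda>A'. \<phi> A' B) A = kosz g (\<lambda>B. hcomp ?d (\<theta> B)) B"
        if B: "B \<subseteq> {..<p}" "n + card B = p" for B
      proof -
        have "hom (?d + \<beta>) (ksgn j A * f j * \<phi> (A - {j}) B)" if "j \<in> A" for j
        proof -
          have "hom (e + int n * (\<alpha> - \<beta>)) (\<phi> (A - {j}) B)"
            using \<phi>2[of "A - {j}" B] cA[OF that] B by simp
          moreover have "hom \<alpha> (f j)" using homf A(1) that by auto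
          ultimately have "hom (0 + \<alpha> + (e + int n * (\<alpha> - \<beta>))) (ksgn j A * f j * \<phi> (A - {j}) B)"
            by (intro hom_mult hom_ksgn)
          then show ?thesis by (simp add: algebra_simps)
        qed
        then have "hom (?d + \<beta>) (kosz f (\<lambda>A'. \<phi> A' B) A)"
          unfolding kosz_def by (rule hom_sum)
        then have "kosz f (\<lambda>A'. \<phi> A' B) A = hcomp (?d + \<beta>) (kosz f (\<lambda>A'. \<phi> A' B) A)"
          by (simp only: hom_iff_hcomp)
        also have "\<dots> = hcomp (?d + \<beta>) (kosz g \<theta> B)"
          using \<theta>[OF B] by simp
        also have "\<dots> = kosz g (\<lambda>B. hcomp (?d + \<beta> - \<beta>) (\<theta> B)) B"
          using B homg by (intro hcomp_kosz) auto
        finally show ?thesis by simp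
      qed
      then show ?thesis
        by (intro exI[of _ "\<lambda>B. hcomp ?d (\<theta> B)"]) auto
    qed
    obtain \<Theta> where \<Theta>: "\<And>A B. A \<subseteq> {..<m} \<Longrightarrow> card A = Suc n \<Longrightarrow> B \<subseteq> {..<p} \<Longrightarrow> n + card B = p \<Longrightarrow>
         kosz f (\<lambda>A'. \<phi> A' B) A = kosz g (\<Theta> A) B"
       "\<And>A B. A \<subseteq> {..<m} \<Longrightarrow> card A = Suc n \<Longrightarrow> hom ?d (\<Theta> A B)"
    proof -
      have "\<forall>A. \<exists>\<theta>. A \<subseteq> {..<m} \<and> card A = Suc n \<longrightarrow>
        (\<forall>B. B \<subseteq> {..<p} \<and> n + card B = p \<longrightarrow> kosz f (\<lambda>A'. \<phi> A' B) A = kosz g \<theta> B) \<and> (\<forall>B. hom ?d (\<theta> B))"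
        using lift by meson
      then obtain \<Theta> where "\<forall>A. A \<subseteq> {..<m} \<and> card A = Suc n \<longrightarrow>
        (\<forall>B. B \<subseteq> {..<p} \<and> n + card B = p \<longrightarrow> kosz f (\<lambda>A'. \<phi> A' B) A = kosz g (\<Theta> A) B) \<and> (\<forall>B. hom ?d (\<Theta> A B))"
        by (rule choice[THEN exE])
      then show ?thesis by (intro that[of \<Theta>]) (blast, blast)
    qed
    define \<psi> where "\<psi> A = (if card A = Suc n then \<Theta> A else \<phi> A)" for A
    have "good (Suc n) \<psi>"
      unfolding good_def
    proof (intro conjI allI impI)
      show "\<psi> {} {..<p} = z" by (simp add: \<psi>_def \<phi>0)
    next
      fix A B
      assume AB: "A \<subseteq> {..<m} \<and> B \<subseteq> {..<p} \<and> card A + card B = Suc p \<and> card A \<le> Suc n"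
      have "card (A - {j}) \<noteq> Suc n" if "j \<in> A" for j
        using AB that finm[of A] card_Diff1_less[of A j] by linarith
      then have "kosz f (\<lambda>A'. \<psi> A' B) A = kosz f (\<lambda>A'. \<phi> A' B) A"
        by (intro kosz_cong) (simp add: \<psi>_def)
      also have "\<dots> = kosz g (\<psi> A) B"
      proof (cases "card A = Suc n")
        case True
        then show ?thesis using AB \<Theta>(1)[of A B] by (simp add: \<psi>_def)
      next
        case False
        then show ?thesis using AB \<phi>1[of A B] by (simp add: \<psi>_def)
      qed
      finally show "kosz f (\<lambda>A'. \<psi> A' B) A = kosz g (\<psi> A) B" .
    next
      fix A B
      assume AB: "A \<subseteq> {..<m} \<and> B \<subseteq> {..<p} \<and> card A + card B = p \<and> card A \<le> Suc n"
      show "hom (e + int (card A) * (\<alpha> - \<beta>)) (\<psi> A B)"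
      proof (cases "card A = Suc n")
        case True
        then show ?thesis using AB \<Theta>(2)[of A B] by (simp add: \<psi>_def)
      next
        case False
        then show ?thesis using AB \<phi>2[of A B] by (simp add: \<psi>_def)
      qed
    qed
    then show ?case by (intro exI[of _ \<psi>])
  qed
  then obtain \<phi> where \<phi>: "good m \<phi>" by blast
  have "card A \<le> m" if "A \<subseteq> {..<m}" for A
    using card_mono[OF _ that] by simp
  note card_le = this
  show ?thesis
  proof (intro exI[of _ \<phi>] conjI)
    show "\<phi> {} {..<p} = z"
      using \<phi> unfolding good_def by (elim conjE)
    show "kosz_map f m g p \<phi>"
      unfolding kosz_map_def
      by (intro allI impI, rule \<phi>[unfolded good_def, THEN conjunct2, THEN conjunct1, rule_format])
        (use card_le in blast)
    show "\<forall>A B. A \<subseteq> {..<m} \<and> B \<subseteq> {..<p} \<and> card A + card B = p \<longrightarrow>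
        hom (e + int (card A) * (\<alpha> - \<beta>)) (\<phi> A B)"
      by (intro allI impI, rule \<phi>[unfolded good_def, THEN conjunct2, THEN conjunct2, rule_format])
        (use card_le in blast)
  qed
qed

subsection \<open>Regular sequences of forms of the same degree\<close>

definition nzd :: "'a::comm_ring_1 set \<Rightarrow> 'a \<Rightarrow> bool" where
  "nzd X a \<longleftrightarrow> (\<forall>h. h * a \<in> idl.span X \<longrightarrow> h \<in> idl.span X)"

lemma nzdI: "(\<And>h. h * a \<in> idl.span X \<Longrightarrow> h \<in> idl.span X) \<Longrightarrow> nzd X a"
  by (simp add: nzd_def)

lemma nzdD: "nzd X a \<Longrightarrow> h * a \<in> idl.span X \<Longrightarrow> h \<in> idl.span X"
  unfolding nzd_def by blast

text \<open>The base X makes regularity relative to an ideal, so that reordering can be proved by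
  induction along the list.\<close>

primrec rsq :: "'a::comm_ring_1 set \<Rightarrow> 'a list \<Rightarrow> bool" where
  "rsq X [] \<longleftrightarrow> True"
| "rsq X (a # xs) \<longleftrightarrow> nzd X a \<and> rsq (insert a X) xs"

lemma idl_span_insert_cong:
  "idl.span X = idl.span Y \<Longrightarrow> idl.span (insert a X) = idl.span (insert a Y)"
  by (simp add: idl.span_insert)

lemma rsq_cong: "idl.span X = idl.span Y \<Longrightarrow> rsq X xs = rsq Y xs"
proof (induction xs arbitrary: X Y)
  case (Cons a xs)
  show ?case
    using Cons.IH[OF idl_span_insert_cong[OF Cons.prems]] by (simp add: nzd_def Cons.prems)
qed simp

lemma rsq_append: "rsq X (xs @ ys) \<longleftrightarrow> rsq X xs \<and> rsq (X \<union> set xs) ys"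
  by (induction xs arbitrary: X) auto

lemma rsq_iff:
  "rsq X xs \<longleftrightarrow> (\<forall>i<length xs. nzd (X \<union> set (take i xs)) (xs ! i))"
proof (induction xs rule: rev_induct)
  case (snoc x xs)
  have "rsq X (xs @ [x]) \<longleftrightarrow> rsq X xs \<and> nzd (X \<union> set xs) x"
    by (simp add: rsq_append)
  then show ?case
    unfolding snoc.IH by (auto simp: All_less_Suc nth_append)
qed simp

lemma rsq_kreg:
  assumes "rsq {} xs"
  shows "kreg (nth xs) (length xs)"
  unfolding kreg_def
proof (intro allI impI)
  fix i h assume i: "i < length xs" and h: "h * xs ! i \<in> idl.span (nth xs ` {..<i})"
  have *: "nth xs ` {..<i} = {} \<union> set (take i xs)"
    using nth_image[of i xs] i by (simp add: lessThan_atLeast0)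
  show "h \<in> idl.span (nth xs ` {..<i})"
    using assms i h nzdD unfolding rsq_iff * by blast
qed

text \<open>Homogeneity replaces the local hypothesis in the permutability of regular sequences:
  Nakayama's lemma becomes a descent on degrees, which needs \<alpha> > 0.\<close>

lemma rsq_swap:
  fixes a b :: "('v::finite, 'k::comm_ring_1) mpoly"
  assumes X: "\<forall>x\<in>X. \<exists>d. hom d x" and a: "hom \<alpha> a" "\<alpha> > 0" and b: "hom \<beta> b"
    and rsq: "rsq X (a # b # ys)"
  shows "rsq X (b # a # ys)"
proof -
  have nza: "h \<in> idl.span X" if "h * a \<in> idl.span X" for h
    using rsq by (intro nzdD[OF _ that]) simp
  have nzb: "h \<in> idl.span (insert a X)" if "h * b \<in> idl.span (insert a X)" for h
    using rsq by (intro nzdD[OF _ that]) simp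
  have X': "\<forall>x\<in>insert a X. \<exists>d. hom d x"
    using X a by blast
  \<comment> \<open>If z b = 0 modulo X, then z = k' a modulo X; cancelling a in k' b a = 0 leaves
    k' b = 0 with k' of degree lower by \<alpha>.\<close>
  have hom_b: "z \<in> idl.span X" if "hom (int d) z" "z * b \<in> idl.span X" for d z
    using that
  proof (induction d arbitrary: z rule: less_induct)
    case (less d)
    have "z \<in> idl.span (insert a X)"
      by (rule nzb) (use less.prems(2) idl.span_mono[OF subset_insertI] in blast)
    then obtain k where k: "z - k * a \<in> idl.span X"
      by (auto simp: idl.span_breakdown_eq)
    define k' where "k' = hcomp (int d - \<alpha>) k"
    have "hcomp (int d) (z - k * a) = z - k' * a"
      using less.prems(1) hcomp_mult[OF a(1), of "int d" k]
      by (simp add: hcomp_diff hom_iff_hcomp k'_def mult.commute)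
    then have k': "z - k' * a \<in> idl.span X"
      using hcomp_in_span[OF k X] by metis
    have "k' \<in> idl.span X"
    proof (cases "int d - \<alpha> < 0")
      case True
      then have "k' = 0" unfolding k'_def by (rule hom_neg[OF hom_hcomp])
      then show ?thesis by (simp add: idl.span_zero)
    next
      case False
      have "(k' * b) * a = z * b - b * (z - k' * a)" by (simp add: algebra_simps)
      also have "\<dots> \<in> idl.span X"
        by (rule idl.span_diff[OF less.prems(2) idl.span_scale[OF k']])
      finally have "k' * b \<in> idl.span X" by (rule nza)
      moreover have "hom (int (nat (int d - \<alpha>))) k'"
        using False by (simp add: k'_def)
      moreover have "nat (int d - \<alpha>) < d"
        using False a(2) by linarith
      ultimately show ?thesis using less.IH by blast
    qed
    then have "(z - k' * a) + a * k' \<in> idl.span X"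
      by (rule idl.span_add[OF k' idl.span_scale])
    then show ?case by (simp add: mult.commute)
  qed
  have b_nzd: "h \<in> idl.span X" if h: "h * b \<in> idl.span X" for h
  proof -
    have "hcomp d h \<in> idl.span X" for d
    proof (cases "d < 0")
      case True
      then have "hcomp d h = 0" using hom_neg[OF hom_hcomp] by blast
      then show ?thesis by (simp add: idl.span_zero)
    next
      case False
      have "hcomp (d + \<beta>) (h * b) = hcomp d h * b"
        using hcomp_mult[OF b, of "d + \<beta>" h] by (simp add: mult.commute)
      then have "hcomp d h * b \<in> idl.span X"
        using hcomp_in_span[OF h X] by metis
      then show ?thesis
        using hom_b[of "nat d" "hcomp d h"] False by simp
    qed
    then show ?thesis
      by (subst hcomp_decomp[of h]) (rule idl.span_sum)
  qed
  have a_nzd: "h \<in> idl.span (insert b X)" if h: "h * a \<in> idl.span (insert b X)" for h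
  proof -
    obtain k where k: "h * a - k * b \<in> idl.span X"
      using h by (auto simp: idl.span_breakdown_eq)
    have "k * b \<in> idl.span (insert a X)"
    proof -
      have "h * a \<in> idl.span (insert a X)"
        by (intro idl.span_scale idl.span_base) simp
      moreover have "h * a - k * b \<in> idl.span (insert a X)"
        using k idl.span_mono[OF subset_insertI, of X a] by blast
      ultimately have "h * a - (h * a - k * b) \<in> idl.span (insert a X)"
        by (rule idl.span_diff)
      then show ?thesis by simp
    qed
    then have "k \<in> idl.span (insert a X)" by (rule nzb)
    then obtain l where l: "k - l * a \<in> idl.span X"
      by (auto simp: idl.span_breakdown_eq)
    have "(h - l * b) * a = (h * a - k * b) + b * (k - l * a)"
      by (simp add: algebra_simps)
    also have "\<dots> \<in> idl.span X"
      by (rule idl.span_add[OF k idl.span_scale[OF l]])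
    finally have "h - l * b \<in> idl.span X" by (rule nza)
    then show ?thesis by (auto simp: idl.span_breakdown_eq)
  qed
  have "rsq (insert a (insert b X)) ys"
    using rsq by (simp add: insert_commute)
  then show ?thesis
    using nzdI[of b X, OF b_nzd] nzdI[of a "insert b X", OF a_nzd] by simp
qed

lemma rsq_rotate:
  fixes a :: "('v::finite, 'k::comm_ring_1) mpoly"
  assumes "\<forall>x\<in>X \<union> set ys. hom \<delta> x" "hom \<delta> a" "\<delta> > 0" "rsq X (ys @ [a])"
  shows "rsq X (a # ys)"
  using assms
proof (induction ys arbitrary: X)
  case (Cons y ys)
  have "rsq (insert y X) (a # ys)"
    using Cons.prems by (intro Cons.IH) auto
  then have "rsq X (y # a # ys)"
    using Cons.prems(4) by simp
  then show ?case
    using Cons.prems by - (rule rsq_swap[where \<alpha> = \<delta> and \<beta> = \<delta>], auto)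
qed simp

section \<open>Exchanging elements of a regular sequence of forms of one degree\<close>

lemma kv_span_subset_idl_span: "kv.span X \<subseteq> idl.span X"
proof (rule kv.span_minimal)
  show "X \<subseteq> idl.span X" by (rule idl.span_superset)
  show "kv.subspace (idl.span X)"
    by (rule kv.subspaceI) (simp_all add: kscale_def idl.span_zero idl.span_add idl.span_scale)
qed

lemma idl_span_eqI:
  assumes "kv.span X = kv.span Y"
  shows "idl.span X = idl.span Y"
proof -
  have "X \<subseteq> idl.span Y" "Y \<subseteq> idl.span X"
    using assms kv.span_superset[of X] kv.span_superset[of Y] kv_span_subset_idl_span[of X] kv_span_subset_idl_span[of Y]
    by auto
  then show ?thesis by (simp add: idl.span_eq)
qed

lemma hom_kv_span:
  fixes X :: "('v::finite, 'k::field) mpoly set"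
  assumes "v \<in> kv.span X" "\<forall>x\<in>X. hom \<delta> x"
  shows "hom \<delta> v"
  using assms(1)
proof (induction rule: kv.span_induct_alt)
  case (step c x y)
  then show ?case
    using assms(2) by (auto simp: kscale_def intro!: hom_add hom_cst_mult)
qed simp

text \<open>Steinitz exchange: v is a nonzero multiple of some r modulo the span of the elements
  before r. It can take the place of r without changing the later ideals, and then moves forward to
  just behind us because all degrees agree.\<close>

lemma rsq_exchange_step:
  fixes v :: "('v::finite, 'k::field) mpoly"
  assumes rsq: "rsq {} (us @ rs)" and hom: "\<forall>x\<in>set (us @ rs). hom \<delta> x" and \<delta>: "\<delta> > 0"
    and v: "v \<in> kv.span (set (us @ rs))" "v \<notin> kv.span (set us)"
  obtains rs' where "length rs = Suc (length rs')" "rsq {} (us @ v # rs')"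
    "kv.span (set (us @ v # rs')) = kv.span (set (us @ rs))"
proof -
  have "\<exists>ys r zs. rs = ys @ r # zs \<and> v \<notin> kv.span (set us \<union> set ys) \<and> v \<in> kv.span (insert r (set us \<union> set ys))"
    using v(1)
  proof (induction rs rule: rev_induct)
    case Nil
    then show ?case using v(2) by simp
  next
    case (snoc x xs)
    show ?case
    proof (cases "v \<in> kv.span (set (us @ xs))")
      case True
      then obtain ys r zs where "xs = ys @ r # zs"
          "v \<notin> kv.span (set us \<union> set ys)" "v \<in> kv.span (insert r (set us \<union> set ys))"
        using snoc.IH by blast
      then show ?thesis
        by (intro exI[of _ ys] exI[of _ r] exI[of _ "zs @ [x]"]) simp
    next
      case False
      then show ?thesis
        using snoc.prems by (intro exI[of _ xs] exI[of _ x] exI[of _ "[]"]) simp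
    qed
  qed
  then obtain ys r zs where rs: "rs = ys @ r # zs"
    and nin: "v \<notin> kv.span (set us \<union> set ys)" and inr: "v \<in> kv.span (insert r (set us \<union> set ys))"
    by blast
  let ?S = "set us \<union> set ys"
  have "r \<in> kv.span (insert v ?S)"
    using kv.in_span_insert[OF inr nin] .
  then have eq: "kv.span (insert v ?S) = kv.span (insert r ?S)"
    using inr kv.span_superset[of "insert v ?S"] kv.span_superset[of "insert r ?S"]
    by (subst kv.span_eq) auto
  obtain c where c: "v - kscale c r \<in> kv.span ?S"
    using inr by (auto simp: kv.span_breakdown_eq)
  then have "c \<noteq> 0" using nin by auto
  have r: "nzd ?S r"
    and zs: "rsq (insert r ?S) zs"
    and us: "rsq {} us" and ys: "rsq (set us) ys"
    using rsq by (simp_all add: rs rsq_append)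
  have homv: "hom \<delta> v"
    using hom_kv_span[OF v(1) hom] .
  have "h \<in> idl.span ?S" if h: "h * v \<in> idl.span ?S" for h
  proof -
    have "(h * cst c) * r = h * v - h * (v - kscale c r)"
      by (simp add: kscale_def algebra_simps)
    also have "\<dots> \<in> idl.span ?S"
      by (rule idl.span_diff[OF h idl.span_scale[OF subsetD[OF kv_span_subset_idl_span c]]])
    finally have "h * cst c \<in> idl.span ?S" by (rule nzdD[OF r])
    then have "cst (inverse c) * (h * cst c) \<in> idl.span ?S" by (rule idl.span_scale)
    moreover have "cst (inverse c) * (h * cst c) = h * cst (inverse c * c)"
      unfolding cst_mult by (simp only: mult_ac)
    ultimately show ?thesis using \<open>c \<noteq> 0\<close> by simp
  qed
  then have "nzd ?S v" by (rule nzdI)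
  then have "rsq (set us) (ys @ [v])"
    using ys by (simp add: rsq_append)
  then have "rsq (set us) (v # ys)"
    using hom rs homv \<delta> by (intro rsq_rotate[where \<delta> = \<delta>]) auto
  moreover have "rsq (insert v ?S) zs"
    using zs rsq_cong[OF idl_span_eqI[OF eq]] by simp
  ultimately have "rsq {} (us @ v # (ys @ zs))"
    using us by (auto simp: rsq_append)
  moreover have "kv.span (set (us @ v # (ys @ zs))) = kv.span (set (us @ rs))"
  proof -
    have "kv.span (insert v ?S \<union> set zs) = kv.span (insert r ?S \<union> set zs)"
      unfolding kv.span_Un eq ..
    then show ?thesis by (simp add: rs Un_ac)
  qed
  ultimately show ?thesis
    by (intro that[of "ys @ zs"]) (simp_all add: rs)
qed

text \<open>Supplies adapted generators: independent linear forms completed by variables, and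
  generators of I that begin with prescribed quadrics.\<close>

lemma rsq_exchange:
  fixes us :: "('v::finite, 'k::field) mpoly list"
  assumes rsq: "rsq {} fs" and hom: "\<forall>x\<in>set fs. hom \<delta> x" and \<delta>: "\<delta> > 0"
    and us: "distinct us" "kv.independent (set us)" "set us \<subseteq> kv.span (set fs)"
  obtains rs where "length fs = length us + length rs" "rsq {} (us @ rs)"
    "kv.span (set (us @ rs)) = kv.span (set fs)"
proof -
  have "\<exists>rs. length fs = length us + length rs \<and> rsq {} (us @ rs) \<and> kv.span (set (us @ rs)) = kv.span (set fs)"
    using us
  proof (induction us rule: rev_induct)
    case Nil
    then show ?case using rsq by (intro exI[of _ fs]) simp
  next
    case (snoc v us)
    have ind: "kv.independent (set us)" "v \<notin> kv.span (set us)"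
      using snoc.prems(1,2) by (simp_all add: kv.independent_insert split: if_splits)
    then obtain rs where rs: "length fs = length us + length rs" "rsq {} (us @ rs)"
      "kv.span (set (us @ rs)) = kv.span (set fs)"
      using snoc by auto
    have "\<forall>x\<in>set (us @ rs). hom \<delta> x"
      using hom_kv_span[OF _ hom] rs(3) kv.span_superset by blast
    moreover have "v \<in> kv.span (set (us @ rs))"
      using snoc.prems(3) rs(3) by simp
    ultimately obtain rs' where "length rs = Suc (length rs')" "rsq {} (us @ v # rs')"
       "kv.span (set (us @ v # rs')) = kv.span (set (us @ rs))"
      using rsq_exchange_step[OF rs(2) _ \<delta> _ ind(2)] by blast
    then show ?case
      using rs by (intro exI[of _ rs']) simp
  qed
  then show ?thesis using that by blast
qed

lemma rsq_vars:
  assumes "distinct vs" "set vs \<inter> X = {}"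
  shows "rsq (var ` X :: ('v::finite, 'k::comm_ring_1) mpoly set) (map var vs)"
  using assms
proof (induction vs arbitrary: X)
  case (Cons v vs)
  have "rsq (var ` insert v X :: ('v, 'k) mpoly set) (map var vs)"
    using Cons.prems by (intro Cons.IH) auto
  moreover have "nzd (var ` X) (var v :: ('v, 'k) mpoly)"
    using Cons.prems by (intro nzdI, elim var_nzd_mod_vars[rotated]) auto
  ultimately show ?case by simp
qed simp

lemma kreg_linear_forms:
  fixes us :: "('v::finite, 'k::field) mpoly list"
  assumes "distinct us" "kv.independent (set us)" "\<forall>u\<in>set us. hom 1 u"
  shows "kreg (nth us) (length us)"
proof -
  obtain vs :: "'v list" where vs: "set vs = UNIV" "distinct vs"
    using finite_distinct_list[OF finite] by blast
  have rsq: "rsq {} (map var vs :: ('v, 'k) mpoly list)"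
    using rsq_vars[of vs "{}"] vs by simp
  have "u \<in> kv.span (set (map var vs))" if "u \<in> set us" for u
  proof -
    have "hom 1 u" using assms(3) that by blast
    then obtain c where "u = linform c" using hom_1_linform by blast
    then have "u = (\<Sum>v\<in>UNIV. kscale (c v) (var v))"
      by (simp add: linform_sum kscale_def)
    moreover have "(\<Sum>v\<in>UNIV. kscale (c v) (var v)) \<in> kv.span (set (map var vs))"
      by (intro kv.span_sum kv.span_scale kv.span_base) (simp add: vs)
    ultimately show ?thesis by simp
  qed
  then have "set us \<subseteq> kv.span (set (map var vs))"
    by blast
  moreover have "\<forall>x\<in>set (map var vs). hom 1 (x :: ('v, 'k) mpoly)"
    by simp
  ultimately obtain rs where "rsq {} (us @ rs)"
    using rsq_exchange[of "map var vs" 1 us] rsq assms(1,2) by (metis zero_less_one)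
  then have "rsq {} us" by (simp add: rsq_append)
  then show ?thesis by (rule rsq_kreg)
qed

lemma rsq_independent:
  fixes xs :: "('v::finite, 'k::field) mpoly list"
  assumes "rsq {} xs" "1 \<notin> idl.span (set xs)"
  shows "distinct xs \<and> kv.independent (set xs)"
  using assms
proof (induction xs rule: rev_induct)
  case Nil
  then show ?case by (simp add: kv.independent_empty)
next
  case (snoc x xs)
  have 1: "1 \<notin> idl.span (set xs)"
    using snoc.prems(2) idl.span_mono[of "set xs" "set (xs @ [x])"] by auto
  have "x \<notin> idl.span (set xs)"
  proof
    assume "x \<in> idl.span (set xs)"
    moreover have "nzd (set xs) x"
      using snoc.prems(1) by (simp add: rsq_append)
    ultimately show False using 1 nzdD[of "set xs" x 1] by simp
  qed
  then have "x \<notin> kv.span (set xs)" "x \<notin> set xs"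
    using kv_span_subset_idl_span idl.span_base by blast+
  moreover have "distinct xs \<and> kv.independent (set xs)"
    using snoc.prems(1) 1 by (intro snoc.IH) (simp_all add: rsq_append)
  ultimately show ?case
    using kv.independent_insertI[of x "set xs"] by simp
qed

lemma hcomp_ideal_low:
  fixes us :: "('v::finite, 'k::comm_ring_1) mpoly set"
  assumes "\<forall>u\<in>us. hom \<delta> u" "p \<in> idl.span us" "d < \<delta>"
  shows "hcomp d p = 0"
  using assms(2)
proof (induction rule: idl.span_induct_alt)
  case (step c x y)
  have "hcomp d (x * c) = x * hcomp (d - \<delta>) c"
    using hcomp_mult[of \<delta> x d c] step assms(1) by simp
  also have "hcomp (d - \<delta>) c = 0"
    using hom_neg[OF hom_hcomp, of "d - \<delta>" c] assms(3) by simp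
  finally show ?case
    using step by (simp add: hcomp_add mult.commute)
qed simp

subsection \<open>Annihilators of spaces of linear forms modulo a complete intersection of quadrics\<close>

lemma image_nth_lessThan: "nth xs ` {..<length xs} = set xs"
  by (auto simp: set_conv_nth)

lemma hom_nth: "\<forall>x\<in>set xs. hom d x \<Longrightarrow> j < length xs \<Longrightarrow> hom d (xs ! j)"
  by simp

lemma kosz_map_exists_list:
  fixes fs gs :: "('v::finite, 'k::comm_ring_1) mpoly list"
  assumes "kreg (nth gs) (length gs)" "\<forall>x\<in>set fs. hom \<alpha> x" "\<forall>x\<in>set gs. hom \<beta> x" "hom e z"
    and z: "\<forall>x\<in>set fs. z * x \<in> idl.span (set gs)"
  shows "\<exists>\<phi>. kosz_map (nth fs) (length fs) (nth gs) (length gs) \<phi> \<and> \<phi> {} {..<length gs} = z \<and>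
    (\<forall>A B. A \<subseteq> {..<length fs} \<and> B \<subseteq> {..<length gs} \<and> card A + card B = length gs \<longrightarrow>
      hom (e + int (card A) * (\<alpha> - \<beta>)) (\<phi> A B))"
proof -
  have *: "z * fs ! j \<in> idl.span (nth gs ` {..<length gs})" if "j < length fs" for j
    using z that unfolding image_nth_lessThan by simp
  show ?thesis
    by (rule kosz_map_exists[OF assms(1) hom_nth[OF assms(2)] hom_nth[OF assms(3)] assms(4) *])
qed

text \<open>The component of the lift of z in homological degree i has degree e - i. With more than
  e linear forms the source reaches homological degree e + 1, where the lift must vanish.\<close>

theorem annihilator_degree_bound:
  fixes us qs :: "('v::finite, 'k::field) mpoly list"
  assumes qs: "rsq {} qs" "\<forall>q\<in>set qs. hom 2 q"
    and us: "distinct us" "kv.independent (set us)" "\<forall>u\<in>set us. hom 1 u"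
    and z: "hom (int e) z" "\<forall>u\<in>set us. z * u \<in> idl.span (set qs)"
    and less: "e < length us"
  shows "z \<in> idl.span (set qs)"
proof -
  obtain \<phi> where \<phi>: "kosz_map (nth us) (length us) (nth qs) (length qs) \<phi>" "\<phi> {} {..<length qs} = z"
    "\<forall>A B. A \<subseteq> {..<length us} \<and> B \<subseteq> {..<length qs} \<and> card A + card B = length qs \<longrightarrow>
      hom (int e + int (card A) * (1 - 2)) (\<phi> A B)"
    using kosz_map_exists_list[OF rsq_kreg[OF qs(1)] us(3) qs(2) z] by (elim exE conjE)
  have "\<phi> {} {..<length qs} \<in> idl.span (nth qs ` {..<length qs})"
  proof (rule kosz_map_descent[OF kreg_linear_forms[OF us] \<phi>(1), of "Suc e"])
    show "Suc e \<le> length us" using less by simp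
    fix A B
    assume "A \<subseteq> {..<length us}" "B \<subseteq> {..<length qs}" "card A = Suc e" "card A + card B = length qs"
    then have "hom (int e + int (card A) * (1 - 2)) (\<phi> A B)" "card A = Suc e"
      using \<phi>(3)[THEN spec, of A, THEN spec, of B] by blast+
    then have "hom (- 1) (\<phi> A B)" by simp
    then show "\<phi> A B = 0" by (rule hom_neg) simp
  qed
  then show ?thesis by (simp add: \<phi>(2) image_nth_lessThan)
qed

text \<open>A height bound by Koszul complexes: the inclusion of ideals lifts 1 to a map from the
  complex of ws to that of us, which is zero in degree length us + 1. If ws were longer, this map
  would be null-homotopic and 1 would lie in (us).\<close>

lemma quadrics_in_linear_ideal:
  fixes us qs ws :: "('v::finite, 'k::field) mpoly list"
  assumes qs: "rsq {} qs" "\<forall>q\<in>set qs. hom 2 q"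
    and us: "distinct us" "kv.independent (set us)" "\<forall>u\<in>set us. hom 1 u"
    and ws: "distinct ws" "kv.independent (set ws)" "set ws \<subseteq> kv.span (set qs)" "set ws \<subseteq> idl.span (set us)"
  shows "length ws \<le> length us"
proof (rule ccontr)
  assume less: "\<not> length ws \<le> length us"
  obtain rs where "rsq {} (ws @ rs)"
    using rsq_exchange[OF qs _ ws(1,2,3)] by auto
  then have reg: "kreg (nth ws) (length ws)"
    by (intro rsq_kreg) (simp add: rsq_append)
  have homws: "\<forall>w\<in>set ws. hom 2 w"
    using hom_kv_span[OF _ qs(2)] ws(3) by blast
  have *: "\<forall>x\<in>set ws. 1 * x \<in> idl.span (set us)"
    using ws(4) by auto
  obtain \<phi> where \<phi>: "kosz_map (nth ws) (length ws) (nth us) (length us) \<phi>" "\<phi> {} {..<length us} = 1"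
    using kosz_map_exists_list[OF kreg_linear_forms[OF us] homws us(3) hom_1 *] by (elim exE conjE)
  have "\<phi> {} {..<length us} \<in> idl.span (nth us ` {..<length us})"
    by (rule kosz_map_descent[OF reg \<phi>(1), of "Suc (length us)"]) (use less in auto)
  then have "hcomp 0 (1 :: ('v, 'k) mpoly) = 0"
    using hcomp_ideal_low[OF us(3), of _ 0] by (simp add: \<phi>(2) image_nth_lessThan)
  moreover have "hcomp 0 (1 :: ('v, 'k) mpoly) = 1"
    using hom_1 by (simp only: hom_iff_hcomp)
  ultimately show False by simp
qed

text \<open>In homological degree length us the lift consists of constants. With generators of I
  chosen so that those in (us) come first, all of these constants but one are forced to vanish, and
  a combination of z1 and z2 removes the last.\<close>

theorem annihilator_one_dimensional:
  fixes us qs :: "('v::finite, 'k::field) mpoly list"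
  assumes qs: "rsq {} qs" "\<forall>q\<in>set qs. hom 2 q" "1 \<notin> idl.span (set qs)"
    and us: "distinct us" "kv.independent (set us)" "\<forall>u\<in>set us. hom 1 u"
    and z1: "hom (int (length us)) z1" "\<forall>u\<in>set us. z1 * u \<in> idl.span (set qs)"
    and z2: "hom (int (length us)) z2" "\<forall>u\<in>set us. z2 * u \<in> idl.span (set qs)"
  obtains a b where "a \<noteq> 0 \<or> b \<noteq> 0" "cst a * z1 + cst b * z2 \<in> idl.span (set qs)"
proof -
  let ?w = "length us"
  define Q where "Q = kv.span (set qs) \<inter> idl.span (set us)"
  obtain W where W: "W \<subseteq> Q" "kv.independent W" "Q \<subseteq> kv.span W"
    using kv.maximal_independent_subset by blast
  have "finite W"
    using kv.independent_span_bound[of "set qs" W] W by (auto simp: Q_def)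
  then obtain ws where ws: "set ws = W" "distinct ws"
    using finite_distinct_list by blast
  have wsub: "set ws \<subseteq> kv.span (set qs)" "set ws \<subseteq> idl.span (set us)"
    using W ws by (auto simp: Q_def)
  have t: "length ws \<le> ?w"
    using quadrics_in_linear_ideal[OF qs(1,2) us ws(2) _ wsub] W ws by simp
  obtain rs where rs: "rsq {} (ws @ rs)" "kv.span (set (ws @ rs)) = kv.span (set qs)"
    using rsq_exchange[OF qs(1,2) _ ws(2) _ wsub(1)] W(2) ws(1) by auto
  define gs where "gs = ws @ rs"
  let ?N = "length gs"
  have gs: "rsq {} gs" "kv.span (set gs) = kv.span (set qs)"
    using rs by (simp_all add: gs_def)
  have I: "idl.span (set gs) = idl.span (set qs)"
    by (rule idl_span_eqI[OF gs(2)])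
  have homgs: "\<forall>g\<in>set gs. hom 2 g"
    using hom_kv_span[OF _ qs(2)] gs(2) kv.span_superset by blast
  have ind: "distinct gs" "kv.independent (set gs)"
    using rsq_independent[OF gs(1)] qs(3) I by auto
  have ex: "\<exists>\<phi>. kosz_map (nth us) ?w (nth gs) ?N \<phi> \<and> \<phi> {} {..<?N} = z \<and>
    (\<forall>A B. A \<subseteq> {..<?w} \<and> B \<subseteq> {..<?N} \<and> card A + card B = ?N \<longrightarrow>
      hom (int ?w + int (card A) * (1 - 2)) (\<phi> A B))"
    if z: "hom (int ?w) z" "\<forall>u\<in>set us. z * u \<in> idl.span (set qs)" for z
    by (rule kosz_map_exists_list[OF rsq_kreg[OF gs(1)] us(3) homgs z(1)]) (use z(2) I in simp)
  obtain \<phi>1 where \<phi>1: "kosz_map (nth us) ?w (nth gs) ?N \<phi>1" "\<phi>1 {} {..<?N} = z1"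
    "\<forall>A B. A \<subseteq> {..<?w} \<and> B \<subseteq> {..<?N} \<and> card A + card B = ?N \<longrightarrow>
      hom (int ?w + int (card A) * (1 - 2)) (\<phi>1 A B)"
    using ex[OF z1] by (elim exE conjE)
  obtain \<phi>2 where \<phi>2: "kosz_map (nth us) ?w (nth gs) ?N \<phi>2" "\<phi>2 {} {..<?N} = z2"
    "\<forall>A B. A \<subseteq> {..<?w} \<and> B \<subseteq> {..<?N} \<and> card A + card B = ?N \<longrightarrow>
      hom (int ?w + int (card A) * (1 - 2)) (\<phi>2 A B)"
    using ex[OF z2] by (elim exE conjE)
  \<comment> \<open>The one constant that may survive belongs to the set B omitting exactly the
    generators from ws; this B has the right size only if length ws = length us.\<close>
  define k where "k \<phi> = Poly_Mapping.lookup (\<phi> {..<?w} {length ws..<?N}) 0"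
    for \<phi> :: "nat set \<Rightarrow> nat set \<Rightarrow> ('v, 'k) mpoly"
  obtain a b where ab: "a \<noteq> 0 \<or> b \<noteq> 0" "a * k \<phi>1 + b * k \<phi>2 = 0"
  proof (cases "k \<phi>1 = 0 \<and> k \<phi>2 = 0")
    case True
    then show ?thesis using that[of 1 0] by simp
  next
    case False
    then show ?thesis using that[of "k \<phi>2" "- k \<phi>1"] by (auto simp: mult.commute)
  qed
  define \<phi> where "\<phi> A B = cst a * \<phi>1 A B + cst b * \<phi>2 A B" for A B
  have \<phi>: "kosz_map (nth us) ?w (nth gs) ?N \<phi>"
    unfolding \<phi>_def by (rule kosz_map_comb[OF \<phi>1(1) \<phi>2(1)])
  let ?A = "{..<?w}"
  have const: "\<phi> ?A B = cst (Poly_Mapping.lookup (\<phi> ?A B) 0)"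
    if "B \<subseteq> {..<?N}" "?w + card B = ?N" for B
  proof -
    have "hom 0 (\<phi>1 ?A B)" "hom 0 (\<phi>2 ?A B)"
      using \<phi>1(3)[THEN spec, of ?A, THEN spec, of B] \<phi>2(3)[THEN spec, of ?A, THEN spec, of B] that
      by simp_all
    then have "hom 0 (\<phi> ?A B)"
      unfolding \<phi>_def by (intro hom_add hom_cst_mult)
    then show ?thesis by (rule hom_0_cst)
  qed
  have zero: "\<phi> ?A B = 0" if B: "B \<subseteq> {..<?N}" "?w + card B = ?N" for B
  proof (cases "{length ws..<?N} \<subseteq> B")
    case True
    have "B = {length ws..<?N}"
      using True B t finite_subset[OF B(1)] by (intro sym[OF card_seteq]) auto
    then have "Poly_Mapping.lookup (\<phi> ?A B) 0 = 0"
      using ab(2) by (simp add: \<phi>_def k_def lookup_add lookup_cst_mult)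
    then show ?thesis using const[OF B] by simp
  next
    case False
    \<comment> \<open>The chain map relation at B' = B with j added puts a combination of the
      generators over B' into (us), hence into the span of ws. The coefficient of gs ! j, which is
      not in ws, must vanish, and up to sign it is the constant at B.\<close>
    then obtain j where j: "j \<in> {length ws..<?N}" "j \<notin> B" by blast
    define B' where "B' = insert j B"
    have B': "B' \<subseteq> {..<?N}" "finite B'" "card B' = Suc (card B)" "B' - {j} = B" "j \<in> B'"
      using B j finite_subset[OF B(1)] by (auto simp: B'_def)
    define c where "c i = Poly_Mapping.lookup (\<phi> ?A (B' - {i})) 0" for i
    have c: "\<phi> ?A (B' - {i}) = cst (c i)" if "i \<in> B'" for i
      unfolding c_def using B B' that by (intro const) auto
    define s where "s i = (- 1 :: 'k) ^ card {a \<in> B'. a < i}" for i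
    have s: "ksgn i B' = (cst (s i) :: ('v, 'k) mpoly)" for i
    proof -
      have "cst ((- 1 :: 'k) ^ n) = (- 1 :: ('v, 'k) mpoly) ^ n" for n
        by (induction n) (simp_all add: cst_mult cst_uminus)
      then show ?thesis by (simp add: ksgn_def s_def)
    qed
    let ?x = "\<Sum>i\<in>B'. kscale (s i * c i) (gs ! i)"
    have "kosz (nth us) (\<lambda>A'. \<phi> A' B') ?A = kosz (nth gs) (\<phi> ?A) B'"
      using \<phi> B B' unfolding kosz_map_def by simp
    also have "\<dots> = ?x"
      unfolding kosz_def by (intro sum.cong refl) (simp add: c s kscale_def cst_mult mult_ac)
    finally have "?x \<in> idl.span (set us)"
      using in_idl_iff_kosz[of ?x "nth us" ?w] unfolding image_nth_lessThan by metis
    moreover have gsQ: "gs ! i \<in> kv.span (set gs)" if "i \<in> B'" for i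
      using that B' by (intro kv.span_base) auto
    then have "?x \<in> kv.span (set qs)"
      unfolding gs(2)[symmetric] by (intro kv.span_sum kv.span_scale)
    ultimately have "?x \<in> kv.span (set ws)"
      using W ws by (auto simp: Q_def)
    moreover have "set ws \<subseteq> set gs - {gs ! j}"
    proof -
      have "gs ! j \<in> set rs"
        using j by (auto simp: gs_def nth_append)
      then show ?thesis using ind(1) by (auto simp: gs_def)
    qed
    ultimately have x: "?x \<in> kv.span (set gs - {gs ! j})"
      using kv.span_mono by blast
    have "kscale (s i * c i) (gs ! i) \<in> kv.span (set gs - {gs ! j})" if "i \<in> B' - {j}" for i
    proof -
      have "gs ! i \<noteq> gs ! j" "gs ! i \<in> set gs"
        using that B' j ind(1) by (auto simp: nth_eq_iff_index_eq)
      then show ?thesis by (intro kv.span_scale kv.span_base) auto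
    qed
    then have "?x - (\<Sum>i\<in>B' - {j}. kscale (s i * c i) (gs ! i)) \<in> kv.span (set gs - {gs ! j})"
      by (intro kv.span_diff x kv.span_sum)
    moreover have "?x - (\<Sum>i\<in>B' - {j}. kscale (s i * c i) (gs ! i)) = kscale (s j * c j) (gs ! j)"
      using B' by (simp add: sum.remove[of B' j])
    ultimately have scaled: "kscale (s j * c j) (gs ! j) \<in> kv.span (set gs - {gs ! j})"
      by simp
    have "s j * c j = 0"
    proof (rule ccontr)
      assume "s j * c j \<noteq> 0"
      moreover have "kscale (inverse (s j * c j)) (kscale (s j * c j) (gs ! j)) \<in> kv.span (set gs - {gs ! j})"
        by (rule kv.span_scale[OF scaled])
      ultimately have "gs ! j \<in> kv.span (set gs - {gs ! j})"
        by (simp only: kv.scale_scale left_inverse kv.scale_one simp_thms)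
      moreover have "gs ! j \<in> set gs" using j by auto
      ultimately show False using ind(2) unfolding kv.dependent_def by blast
    qed
    then have "c j = 0" by (simp add: s_def)
    then show ?thesis using c[OF B'(5)] B'(4) by simp
  qed
  have "\<phi> {} {..<?N} \<in> idl.span (nth gs ` {..<?N})"
  proof (rule kosz_map_descent[OF kreg_linear_forms[OF us] \<phi>, of ?w])
    fix A B
    assume "A \<subseteq> {..<?w}" "B \<subseteq> {..<?N}" "card A = ?w" "card A + card B = ?N"
    moreover from this have "A = ?A" by (simp add: card_subset_eq)
    ultimately show "\<phi> A B = 0" using zero[of B] by simp
  qed simp
  then have "cst a * z1 + cst b * z2 \<in> idl.span (set qs)"
    by (simp add: \<phi>_def \<phi>1(2) \<phi>2(2) image_nth_lessThan I)
  then show ?thesis using ab(1) that by blast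
qed

subsection \<open>Linear algebra in degree one\<close>

abbreviation lf :: "'k::comm_ring_1 ^ 'v::finite \<Rightarrow> ('v, 'k) mpoly" where
  "lf w \<equiv> linform (vec_nth w)"

lemma lf_add: "lf (a + b) = lf a + lf b"
proof -
  have "vec_nth (a + b) = (\<lambda>v. a $ v + b $ v)" by auto
  then show ?thesis by (simp only: linform_add)
qed

lemma lf_scale: "lf (s *s a) = cst s * lf a"
proof -
  have "vec_nth (s *s a) = (\<lambda>v. s * a $ v)" by auto
  then show ?thesis by (simp only: linform_scale)
qed

lemma linear_lf: "Vector_Spaces.linear (*s) kscale (lf :: 'k::field ^ 'v::finite \<Rightarrow> _)"
  by (intro Vector_Spaces.linear.intro module_hom.intro module_hom_axioms.intro)
    (simp_all add: vec.vector_space_axioms kv.vector_space_axioms vec.module_axioms kv.module_axioms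
      lf_add lf_scale kscale_def)

lemma lf_eq_0_iff: "lf w = 0 \<longleftrightarrow> w = 0"
  by (simp add: linform_eq_0_iff vec_eq_iff)

lemma independent_linear_forms:
  fixes W :: "('k::field ^ 'v::finite) set"
  obtains us where "distinct us" "kv.independent (set us)" "length us = vec.dim W" "set us \<subseteq> lf ` W"
proof -
  obtain B where B: "B \<subseteq> W" "vec.independent B" "card B = vec.dim W"
    by (rule vec.basis_exists[of W])
  have inj: "inj_on lf S" for S :: "('k ^ 'v) set"
  proof (rule inj_onI)
    fix a b :: "'k ^ 'v" assume "lf a = lf b"
    then have "a $ v = b $ v" for v
      using lookup_linform[of "vec_nth a" v] lookup_linform[of "vec_nth b" v] by metis
    then show "a = b" by (simp add: vec_eq_iff)
  qed
  have "finite B" using B(2) by (rule vec.finiteI_independent)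
  then obtain bs where bs: "set bs = B" "distinct bs"
    using finite_distinct_list by blast
  have "kv.independent (lf ` B)"
    by (rule module_hom.independent_injective_image[OF linear_lf[folded module_hom_iff_linear] B(2) inj])
  moreover have "length bs = vec.dim W"
    using B(3) bs distinct_card[of bs] by simp
  ultimately show ?thesis
    using B(1) bs inj[of B] by (intro that[of "map lf bs"]) (simp_all add: distinct_map image_mono)
qed

lemma dim_kernel_range:
  fixes E :: "'k::field ^ 'v::finite \<Rightarrow> 'k ^ 'v"
  assumes "Vector_Spaces.linear (*s) (*s) E"
  shows "CARD('v) \<le> vec.dim {v. E v = 0} + vec.dim (range E)"
proof -
  interpret E: Vector_Spaces.linear "(*s)" "(*s)" E by fact
  obtain C where C: "C \<subseteq> range E" "vec.independent C" "range E \<subseteq> vec.span C" "card C = vec.dim (range E)"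
    using vec.basis_exists by blast
  obtain B where B: "B \<subseteq> {v. E v = 0}" "vec.independent B" "{v. E v = 0} \<subseteq> vec.span B" "card B = vec.dim {v. E v = 0}"
    using vec.basis_exists by blast
  have fin: "finite B" "finite C"
    using B C vec.finiteI_independent by auto
  define p where "p = inv_into UNIV E"
  have p: "E (p c) = c" if "c \<in> C" for c
    unfolding p_def using C(1) that by (intro f_inv_into_f) blast
  have "v \<in> vec.span (B \<union> p ` C)" for v
  proof -
    have "E ` p ` C = C" using p by force
    then have "E v \<in> vec.span (E ` p ` C)" using C(3) by auto
    then obtain u where u: "u \<in> vec.span (p ` C)" "E v = E u"
      by (auto simp: E.span_image)
    have "v - u \<in> {v. E v = 0}" using u(2) by (simp add: E.diff)
    then have "v - u \<in> vec.span (B \<union> p ` C)"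
      using B(3) vec.span_mono[of B "B \<union> p ` C"] by blast
    moreover have "u \<in> vec.span (B \<union> p ` C)"
      using u(1) vec.span_mono[of "p ` C" "B \<union> p ` C"] by blast
    ultimately have "(v - u) + u \<in> vec.span (B \<union> p ` C)" by (rule vec.span_add)
    then show ?thesis by simp
  qed
  then have "vec.dim (UNIV :: ('k ^ 'v) set) \<le> card (B \<union> p ` C)"
    using fin by (intro vec.dim_le_card) auto
  also have "\<dots> \<le> card B + card C"
    using card_Un_le[of B "p ` C"] card_image_le[OF fin(2), of p] by linarith
  finally show ?thesis
    by (simp add: card_cart_basis B C)
qed

lemma dim_image_quotient:
  fixes E :: "'k::field ^ 'v::finite \<Rightarrow> 'k ^ 'v"
  assumes "Vector_Spaces.linear (*s) (*s) E" "V \<subseteq> T" "\<And>v. v \<in> V \<Longrightarrow> E v = 0"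
  shows "vec.dim (E ` T) + vec.dim V \<le> vec.dim T"
proof -
  interpret E: Vector_Spaces.linear "(*s)" "(*s)" E by fact
  obtain B where B: "B \<subseteq> V" "vec.independent B" "V \<subseteq> vec.span B" "card B = vec.dim V"
    using vec.basis_exists by blast
  obtain C where C: "B \<subseteq> C" "C \<subseteq> T" "vec.independent C" "T \<subseteq> vec.span C"
    by (rule vec.maximal_independent_subset_extend[OF order_trans[OF B(1) assms(2)] B(2)])
  have fin: "finite C" using C vec.finiteI_independent by auto
  have "E ` T \<subseteq> vec.span (E ` (C - B))"
  proof -
    have "E ` T \<subseteq> vec.span (E ` C)"
      using C(4) by (auto simp: E.span_image)
    also have "\<dots> \<subseteq> vec.span (E ` (C - B))"
    proof (rule vec.span_minimal)
      show "E ` C \<subseteq> vec.span (E ` (C - B))"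
      proof (rule image_subsetI)
        fix x assume x: "x \<in> C"
        show "E x \<in> vec.span (E ` (C - B))"
        proof (cases "x \<in> B")
          case True
          then have "E x = 0" using B(1) assms(3) by blast
          then show ?thesis by (simp only: vec.span_zero)
        next
          case False
          then show ?thesis using x by (intro vec.span_base) blast
        qed
      qed
    qed simp
    finally show ?thesis .
  qed
  then have "vec.dim (E ` T) \<le> card (C - B)"
    using vec.dim_le_card[of "E ` T" "E ` (C - B)"] fin card_image_le[of "C - B" E] by auto
  moreover have "card (C - B) = card C - card B" "card B \<le> card C"
    using fin C(1) finite_subset[OF C(1)] by (auto simp: card_Diff_subset card_mono)
  moreover have "card C = vec.dim T"
    using vec.basis_card_eq_dim[OF C(2,4,3)] .
  ultimately show ?thesis using B(4) by simp
qed

subsection \<open>A point of the incidence variety\<close>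

text \<open>Here X and Y are the values at a point of the generic linear form x and of a vector field y(x)
with x^k y(x) = 0, and D is the differential of y. Property jet says that the vanishing of a
monomial in X and Y persists near the point, so that it may be differentiated.\<close>

locale vanishing_jet =
  fixes qs :: "('v::finite, 'k::field_char_0) mpoly list"
    and X :: "('v, 'k) mpoly" and y :: "'k ^ 'v" and D :: "'k ^ 'v \<Rightarrow> 'k ^ 'v" and k :: nat
  assumes qs: "rsq {} qs" "\<forall>q\<in>set qs. hom 2 q" "1 \<notin> idl.span (set qs)"
    and X: "hom 1 X"
    and y: "y \<noteq> 0"
    and D: "Vector_Spaces.linear (*s) (*s) D"
    and jet: "\<And>a b w. a + b \<le> 5 \<Longrightarrow> X ^ a * lf y ^ b \<in> idl.span (set qs) \<Longrightarrow>
       of_nat a * X ^ (a - 1) * lf y ^ b * lf w + of_nat b * X ^ a * lf y ^ (b - 1) * lf (D w) \<in> idl.span (set qs)"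
    and k: "X ^ k * lf y \<in> idl.span (set qs)" "\<And>j. j < k \<Longrightarrow> X ^ j * lf y \<notin> idl.span (set qs)"
    and k_le: "k \<le> 4" "k + 2 \<le> CARD('v)"
begin

sublocale D: Vector_Spaces.linear "(*s)" "(*s)" D by (rule D)

abbreviation "I \<equiv> idl.span (set qs)"
abbreviation "Y \<equiv> lf y"

definition "ann z = {w. z * lf w \<in> I}"
text \<open>V is the kernel of the differential of the map sending x to the projective point [y(x)],
  and T is the tangent space of the cone over its image.\<close>

definition "V = {v. \<exists>s. D v = s *s y}"
definition "T = vec.span (insert y (range D))"

lemma I_cst_cancel:
  assumes "cst s * p \<in> I" "s \<noteq> 0"
  shows "p \<in> I"
proof -
  have "cst (inverse s) * (cst s * p) \<in> I" by (rule idl.span_scale[OF assms(1)])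
  then show ?thesis using assms(2) by (simp flip: mult.assoc cst_mult)
qed

lemma I_of_nat_cancel: "of_nat n * p \<in> I \<Longrightarrow> n \<noteq> 0 \<Longrightarrow> p \<in> I"
  using I_cst_cancel[of "of_nat n" p] by (simp add: cst_of_nat)

lemma I_mult: "p \<in> I \<Longrightarrow> q * p \<in> I"
  by (rule idl.span_scale)

lemma I_mult_right: "p \<in> I \<Longrightarrow> p * q \<in> I"
  using I_mult[of p q] by (simp add: mult.commute)

lemma I_add_cancel: "p + q \<in> I \<Longrightarrow> q \<in> I \<Longrightarrow> p \<in> I"
  using idl.span_diff[of "p + q" "set qs" q] by simp

lemma I_add_cancel': "p + q \<in> I \<Longrightarrow> p \<in> I \<Longrightarrow> q \<in> I"
  using I_add_cancel[of q p] by (simp add: add.commute)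

lemma hom_XY: "hom (int (a + b)) (X ^ a * Y ^ b)"
  using hom_mult[OF hom_power[OF X, of a] hom_power[OF hom_linform, of b "vec_nth y"]] by simp

lemma subspace_ann: "vec.subspace (ann z)"
proof (rule vec.subspaceI)
  show "0 \<in> ann z"
    using lf_eq_0_iff[of "0 :: 'k ^ 'v"] by (simp add: ann_def idl.span_zero)
  show "a + b \<in> ann z" if "a \<in> ann z" "b \<in> ann z" for a b
    using that by (simp add: ann_def lf_add distrib_left idl.span_add)
  show "s *s a \<in> ann z" if "a \<in> ann z" for s a
  proof -
    have "cst s * (z * lf a) \<in> I" by (rule I_mult) (use that in \<open>simp add: ann_def\<close>)
    then show ?thesis by (simp add: ann_def lf_scale mult_ac)
  qed
qed

lemma dim_ann:
  assumes "hom (int e) z" "z \<notin> I" "W \<subseteq> ann z"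
  shows "vec.dim W \<le> e"
proof (rule ccontr)
  assume *: "\<not> vec.dim W \<le> e"
  obtain us where us: "distinct us" "kv.independent (set us)" "length us = vec.dim W" "set us \<subseteq> lf ` W"
    by (rule independent_linear_forms)
  have "\<forall>u\<in>set us. hom 1 u" "\<forall>u\<in>set us. z * u \<in> I"
    using us(4) assms(3) by (auto simp: ann_def)
  then have "z \<in> I"
    using annihilator_degree_bound[OF qs(1,2) us(1,2) _ assms(1)] us(3) * by simp
  then show False using assms(2) by simp
qed

text \<open>A nonzero z would be annihilated by a space of linear forms of dimension CARD('v), more
  than \<open>dim_ann\<close> allows in degree e.\<close>

lemma socle:
  assumes "hom (int e) z" "\<And>w. z * lf w \<in> I" "e < CARD('v)"
  shows "z \<in> I"
proof (rule ccontr)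
  assume "z \<notin> I"
  then have "vec.dim (UNIV :: ('k ^ 'v) set) \<le> e"
    using assms(2) by (intro dim_ann[OF assms(1)]) (auto simp: ann_def)
  then show False using assms(3) by (simp add: card_cart_basis)
qed

lemma Y_notin: "Y \<notin> I"
proof
  assume "Y \<in> I"
  then have "hcomp 1 Y = 0" using hcomp_ideal_low[OF qs(2), of Y 1] by simp
  moreover have "hcomp 1 Y = Y"
    using hom_linform by (simp only: hom_iff_hcomp)
  ultimately show False using y by (simp only: lf_eq_0_iff)
qed

lemma k_pos: "k \<ge> 1"
  using k(1) Y_notin by (cases k) auto

lemma XY_in: "b \<ge> 1 \<Longrightarrow> a + b = k + 1 \<Longrightarrow> X ^ a * Y ^ b \<in> I"
proof (induction b arbitrary: a rule: nat_induct_at_least)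
  case base
  then show ?case using k(1) by simp
next
  case (Suc b)
  have IH: "X ^ Suc a * Y ^ b \<in> I"
    by (rule Suc.IH) (use Suc.prems in simp)
  have "X ^ a * Y ^ Suc b * lf w \<in> I" for w
  proof -
    \<comment> \<open>The factor Y turns the second term into a multiple of the relation from the
      induction. What remains is annihilated by every w, and its degree k + 1 is below
      CARD('v).\<close>
    have "Y * (of_nat (Suc a) * X ^ a * Y ^ b * lf w + of_nat b * X ^ Suc a * Y ^ (b - 1) * lf (D w)) \<in> I"
      using jet[OF _ IH, of w] Suc.prems k_le(1) by (intro I_mult) simp
    moreover have "Y * (of_nat (Suc a) * X ^ a * Y ^ b * lf w + of_nat b * X ^ Suc a * Y ^ (b - 1) * lf (D w))
       = of_nat (Suc a) * (X ^ a * Y ^ Suc b * lf w) + of_nat b * lf (D w) * (X ^ Suc a * (Y * Y ^ (b - 1)))"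
      by (simp add: algebra_simps)
    moreover have "Y * Y ^ (b - 1) = Y ^ b"
      using Suc.hyps by (metis Suc_diff_1 less_le_trans power_Suc zero_less_one)
    ultimately have "of_nat (Suc a) * (X ^ a * Y ^ Suc b * lf w) + of_nat b * lf (D w) * (X ^ Suc a * Y ^ b) \<in> I"
      by simp
    then have "of_nat (Suc a) * (X ^ a * Y ^ Suc b * lf w) \<in> I"
      by (rule I_add_cancel) (rule I_mult[OF IH])
    then show ?thesis by (rule I_of_nat_cancel) simp
  qed
  then show ?case
    using Suc.prems k_le(2) by (intro socle[OF hom_XY]) auto
qed

text \<open>Along V the derivative of y is a multiple of y, so the second term of the jet is a
  multiple of the given relation.\<close>

lemma V_ann:
  assumes "X ^ a * Y ^ b \<in> I" "a \<ge> 1" "b \<ge> 1" "a + b \<le> 5"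
  shows "V \<subseteq> ann (X ^ (a - 1) * Y ^ b)"
proof
  fix v assume "v \<in> V"
  then obtain s where s: "D v = s *s y" by (auto simp: V_def)
  have Yb: "Y ^ (b - 1) * Y = Y ^ b"
    using assms(3) by (metis Suc_diff_1 less_le_trans power_Suc2 zero_less_one)
  have "of_nat a * X ^ (a - 1) * Y ^ b * lf v + of_nat b * X ^ a * Y ^ (b - 1) * lf (D v) \<in> I"
    by (rule jet[OF assms(4,1)])
  moreover have "of_nat b * X ^ a * Y ^ (b - 1) * lf (D v) = (of_nat b * cst s) * (X ^ a * (Y ^ (b - 1) * Y))"
    by (simp add: s lf_scale mult_ac)
  then have "of_nat b * X ^ a * Y ^ (b - 1) * lf (D v) \<in> I"
    unfolding Yb using I_mult[OF assms(1)] by simp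
  ultimately have "of_nat a * X ^ (a - 1) * Y ^ b * lf v \<in> I" by (rule I_add_cancel)
  then have "of_nat a * (X ^ (a - 1) * Y ^ b * lf v) \<in> I" by (simp add: mult_ac)
  then have "X ^ (a - 1) * Y ^ b * lf v \<in> I" by (rule I_of_nat_cancel) (use assms(2) in simp)
  then show "v \<in> ann (X ^ (a - 1) * Y ^ b)" by (simp add: ann_def)
qed

text \<open>The test element X^(k-1) Y has degree k and is nonzero by minimality of k.\<close>

lemma dim_V_le: "vec.dim V \<le> k"
proof (rule dim_ann)
  show "hom (int k) (X ^ (k - 1) * Y ^ 1)"
    using hom_XY[of "k - 1" 1] k_pos by simp
  show "X ^ (k - 1) * Y ^ 1 \<notin> I" using k(2)[of "k - 1"] k_pos by simp
  show "V \<subseteq> ann (X ^ (k - 1) * Y ^ 1)"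
    using k(1) k_pos k_le by (intro V_ann) auto
qed

lemma Y_power_mono: "Y ^ i \<in> I \<Longrightarrow> i \<le> j \<Longrightarrow> Y ^ j \<in> I"
  using I_mult[of "Y ^ i" "Y ^ (j - i)"] by (simp flip: power_add)

text \<open>Differentiating Y^(j+1) = 0 gives Y^j D_w y = 0 in characteristic zero.\<close>

lemma last_power_of_Y:
  obtains j where "1 \<le> j" "j \<le> k" "Y ^ j \<notin> I" "T \<subseteq> ann (Y ^ j)" "vec.dim T \<le> j"
proof -
  have top: "Y ^ (k + 1) \<in> I" using XY_in[of "k + 1" 0] by simp
  define n where "n = (LEAST n. Y ^ n \<in> I)"
  have n: "Y ^ n \<in> I"
    unfolding n_def using top by (rule LeastI[of "\<lambda>n. Y ^ n \<in> I"])
  have least: "Y ^ i \<notin> I" if "i < n" for i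
    using not_less_Least that unfolding n_def by blast
  have n1: "n \<noteq> 0"
    using n qs(3) by (cases n) auto
  have n2: "n \<noteq> 1"
    using n Y_notin by (cases "n = 1") auto
  have n3: "n \<le> k + 1"
    unfolding n_def using top by (rule Least_le[of "\<lambda>n. Y ^ n \<in> I"])
  define j where "j = n - 1"
  have j: "n = Suc j" "1 \<le> j" "j \<le> k" "Y ^ j \<notin> I"
    using n1 n2 n3 least[of j] by (auto simp: j_def)
  have "y \<in> ann (Y ^ j)"
    using n by (simp add: ann_def j(1) mult.commute)
  moreover have "D w \<in> ann (Y ^ j)" for w
  proof -
    have "of_nat 0 * X ^ (0 - 1) * Y ^ n * lf w + of_nat n * X ^ 0 * Y ^ (n - 1) * lf (D w) \<in> I"
      using n n3 k_le by (intro jet) auto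
    then have "of_nat n * (Y ^ j * lf (D w)) \<in> I" by (simp add: j(1) mult_ac)
    then show ?thesis using n1 I_of_nat_cancel by (simp add: ann_def)
  qed
  ultimately have T: "T \<subseteq> ann (Y ^ j)"
    unfolding T_def by (intro vec.span_minimal[OF _ subspace_ann]) auto
  have "hom (int j) (Y ^ j)" using hom_XY[of 0 j] by simp
  then have "vec.dim T \<le> j" using dim_ann[OF _ j(4) T] by simp
  then show ?thesis using that j T by blast
qed

text \<open>Killing the component of D along y turns V into a kernel.\<close>

lemma normalized_differential:
  "\<exists>E. Vector_Spaces.linear (*s) (*s) E \<and> V = {v. E v = 0} \<and>
    (\<forall>w. \<exists>s. D w = E w + s *s y) \<and> vec.dim T = Suc (vec.dim (range E))"
proof -
  obtain i where i: "y $ i \<noteq> 0" using y by (auto simp: vec_eq_iff)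
  define \<theta> where "\<theta> u = u $ i / y $ i" for u :: "'k ^ 'v"
  have \<theta>y: "\<theta> y = 1" using i by (simp add: \<theta>_def)
  have \<theta>: "\<theta> (a + b) = \<theta> a + \<theta> b" "\<theta> (s *s a) = s * \<theta> a" "\<theta> (a - b) = \<theta> a - \<theta> b" for a b s
    by (simp_all add: \<theta>_def add_divide_distrib diff_divide_distrib)
  define E where "E w = D w - \<theta> (D w) *s y" for w
  have lin: "Vector_Spaces.linear (*s) (*s) E"
  proof (intro Vector_Spaces.linear.intro module_hom.intro module_hom_axioms.intro)
    show "E (a + b) = E a + E b" for a b
      by (simp add: E_def D.add \<theta> vec.scale_left_distrib)
    show "E (s *s a) = s *s E a" for s a
      by (simp add: E_def D.scale \<theta> vec.scale_right_diff_distrib vec.scale_scale)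
  qed (simp_all add: vec.vector_space_axioms vec.module_axioms)
  interpret E: Vector_Spaces.linear "(*s)" "(*s)" E by (rule lin)
  have DE: "D w = E w + \<theta> (D w) *s y" for w by (simp add: E_def)
  have V: "V = {v. E v = 0}"
  proof (intro set_eqI iffI)
    fix v assume "v \<in> V"
    then obtain s where "D v = s *s y" by (auto simp: V_def)
    then show "v \<in> {v. E v = 0}" by (simp add: E_def \<theta> \<theta>y)
  next
    fix v assume "v \<in> {v. E v = 0}"
    then have "D v = \<theta> (D v) *s y" by (simp add: E_def)
    then show "v \<in> V" unfolding V_def by blast
  qed
  have "T = vec.span (insert y (range E))"
    unfolding T_def vec.span_eq
  proof
    show "insert y (range D) \<subseteq> vec.span (insert y (range E))"
    proof -
      have "D w \<in> vec.span (insert y (range E))" for w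
        by (subst DE) (intro vec.span_add vec.span_scale vec.span_base; simp)
      then show ?thesis by (auto intro: vec.span_base)
    qed
    show "insert y (range E) \<subseteq> vec.span (insert y (range D))"
    proof -
      have "E w \<in> vec.span (insert y (range D))" for w
        unfolding E_def by (intro vec.span_diff vec.span_scale vec.span_base; simp)
      then show ?thesis by (auto intro: vec.span_base)
    qed
  qed
  moreover have "y \<notin> vec.span (range E)"
  proof
    have sub: "vec.subspace {u. \<theta> u = 0}"
      by (rule vec.subspaceI) (simp_all add: \<theta>, simp add: \<theta>_def)
    have "range E \<subseteq> {u. \<theta> u = 0}"
      by (auto simp: E_def \<theta> \<theta>y)
    then have "vec.span (range E) \<subseteq> {u. \<theta> u = 0}"
      using sub by (rule vec.span_minimal)
    moreover assume "y \<in> vec.span (range E)"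
    ultimately show False using \<theta>y by auto
  qed
  ultimately have "vec.dim T = Suc (vec.dim (range E))"
    by (simp add: vec.dim_insert)
  then show ?thesis using lin V DE by blast
qed

lemma dim_V_T: "CARD('v) + 1 \<le> vec.dim V + vec.dim T"
proof -
  obtain E where E: "Vector_Spaces.linear (*s) (*s) E" "V = {v. E v = 0}"
    "\<forall>w. \<exists>s. D w = E w + s *s y" "vec.dim T = Suc (vec.dim (range E))"
    using normalized_differential by (elim exE conjE)
  then show ?thesis using dim_kernel_range[OF E(1)] by simp
qed

text \<open>All X^(k-b) Y^b with 1 <= b <= k lie in the annihilator of V in degree k, which is at
  most a line when dim V = k. Proportionality carries a relation for one of them over to its
  neighbour.\<close>

lemma maximal_V_imp:
  assumes V: "vec.dim V = k" and b: "2 \<le> b" "b \<le> k"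
  shows "X ^ (k - b) * Y ^ b \<in> I"
proof (rule ccontr)
  assume notin: "X ^ (k - b) * Y ^ b \<notin> I"
  define S where "S = {b. 2 \<le> b \<and> b \<le> k \<and> X ^ (k - b) * Y ^ b \<notin> I}"
  have "finite S" by (rule finite_subset[of _ "{..k}"]) (auto simp: S_def)
  moreover have "S \<noteq> {}" using notin b by (auto simp: S_def)
  ultimately have MaxS: "Max S \<in> S" "\<And>i. i \<in> S \<Longrightarrow> i \<le> Max S" by auto
  \<comment> \<open>With m the largest bad exponent, the monomial after z already vanishes; b >= 2
    leaves a factor Y in its predecessor z2.\<close>
  define m where "m = Max S"
  define z where "z = X ^ (k - m) * Y ^ m"
  define z2 where "z2 = X ^ (k - m + 1) * Y ^ (m - 1)"
  have m2: "2 \<le> m" "m \<le> k" and z: "z \<notin> I"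
    using MaxS(1)[folded m_def] unfolding S_def z_def by auto
  have next_in: "X ^ (k - Suc m) * Y ^ Suc m \<in> I" if "m < k"
  proof (rule ccontr)
    assume "X ^ (k - Suc m) * Y ^ Suc m \<notin> I"
    then have "Suc m \<in> S" using that m2 unfolding S_def by simp
    then show False using MaxS(2)[of "Suc m"] by (simp flip: m_def)
  qed
  have V1: "V \<subseteq> ann z"
    using V_ann[of "k - m + 1" m] XY_in[of m "k - m + 1"] m2 k_le by (simp add: z_def)
  have V2: "V \<subseteq> ann z2"
    using V_ann[of "k - m + 2" "m - 1"] XY_in[of "m - 1" "k - m + 2"] m2 k_le by (simp add: z2_def)
  have homs: "hom (int k) z" "hom (int k) z2"
    using hom_XY[of "k - m" m] hom_XY[of "k - m + 1" "m - 1"] m2 by (simp_all add: z_def z2_def)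
  obtain us where us: "distinct us" "kv.independent (set us)" "length us = vec.dim V" "set us \<subseteq> lf ` V"
    by (rule independent_linear_forms)
  have usz: "\<forall>u\<in>set us. hom 1 u" "\<forall>u\<in>set us. z * u \<in> I" "\<forall>u\<in>set us. z2 * u \<in> I"
    using us(4) V1 V2 by (auto simp: ann_def)
  have homs': "hom (int (length us)) z" "hom (int (length us)) z2"
    using homs us(3) V by simp_all
  obtain \<alpha> \<beta> where ab: "\<alpha> \<noteq> 0 \<or> \<beta> \<noteq> 0" "cst \<alpha> * z + cst \<beta> * z2 \<in> I"
    by (rule annihilator_one_dimensional[OF qs us(1,2) usz(1) homs'(1) usz(2) homs'(2) usz(3)])
  have \<beta>: "\<beta> \<noteq> 0"
    using ab z I_cst_cancel[of \<alpha> z] by auto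
  have "z * lf w \<in> I" for w
  proof -
    \<comment> \<open>The jet of X^(k-m) Y^(m+1): its first term vanishes by maximality of m, or by
      its coefficient k - m = 0.\<close>
    have zD: "z * lf (D w) \<in> I"
    proof -
      have "of_nat (k - m) * X ^ (k - m - 1) * Y ^ Suc m * lf w
          + of_nat (Suc m) * X ^ (k - m) * Y ^ (Suc m - 1) * lf (D w) \<in> I"
        using XY_in[of "Suc m" "k - m"] m2 k_le by (intro jet) auto
      moreover have "of_nat (k - m) * X ^ (k - m - 1) * Y ^ Suc m * lf w \<in> I"
      proof (cases "m < k")
        case True
        then show ?thesis
          using I_mult[OF next_in[OF True], of "of_nat (k - m) * lf w"] by (simp add: mult_ac)
      next
        case False
        then show ?thesis using m2 by (simp add: idl.span_zero)
      qed
      ultimately have "of_nat (Suc m) * X ^ (k - m) * Y ^ (Suc m - 1) * lf (D w) \<in> I"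
        by (rule I_add_cancel')
      then have "of_nat (Suc m) * (z * lf (D w)) \<in> I"
        by (simp only: z_def diff_Suc_1 mult.assoc)
      then show ?thesis by (rule I_of_nat_cancel) simp
    qed
    have "cst \<alpha> * (z * lf (D w)) + cst \<beta> * (z2 * lf (D w)) \<in> I"
      using I_mult_right[OF ab(2), of "lf (D w)"] by (simp only: distrib_right mult.assoc)
    then have "cst \<beta> * (z2 * lf (D w)) \<in> I"
      by (rule I_add_cancel') (rule I_mult[OF zD])
    then have z2D: "z2 * lf (D w) \<in> I"
      using \<beta> by (rule I_cst_cancel)
    \<comment> \<open>The jet of X^(k-m+1) Y^m: its second term is gone, so every w annihilates
      z.\<close>
    have "of_nat (k - m + 1) * X ^ (k - m + 1 - 1) * Y ^ m * lf w
        + of_nat m * X ^ (k - m + 1) * Y ^ (m - 1) * lf (D w) \<in> I"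
      using XY_in[of m "k - m + 1"] m2 k_le by (intro jet) auto
    then have "of_nat (k - m + 1) * (z * lf w) + of_nat m * (z2 * lf (D w)) \<in> I"
      by (simp only: z_def z2_def add_diff_cancel_right' mult.assoc)
    then have "of_nat (k - m + 1) * (z * lf w) \<in> I"
      by (rule I_add_cancel) (rule I_mult[OF z2D])
    then show ?thesis by (rule I_of_nat_cancel) simp
  qed
  then have "z \<in> I"
    by (rule socle[OF homs(1)]) (use k_le(2) in simp)
  then show False using z by simp
qed

theorem contradiction: False
proof -
  obtain j where j: "1 \<le> j" "j \<le> k" "Y ^ j \<notin> I" "T \<subseteq> ann (Y ^ j)" "vec.dim T \<le> j"
    by (rule last_power_of_Y)
  show False
  proof (cases "vec.dim V = k")
    case True
    \<comment> \<open>dim T >= CARD('v) + 1 - k >= 3, and dim T <= j <= k.\<close>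
    then have k3: "k \<ge> 3" using dim_V_T j k_le by linarith
    have XY1: "X ^ 1 * Y ^ (k - 1) \<in> I"
      using maximal_V_imp[OF True, of "k - 1"] k3 by (simp add: Suc_diff_Suc numeral_eq_Suc)
    have "V \<subseteq> ann (X ^ (1 - 1) * Y ^ (k - 1))"
      using k3 k_le by (intro V_ann XY1) auto
    moreover have "hom (int (k - 1)) (X ^ (1 - 1) * Y ^ (k - 1))"
      using hom_XY[of 0 "k - 1"] by simp
    ultimately have "X ^ (1 - 1) * Y ^ (k - 1) \<in> I"
      using dim_ann[of "k - 1" "X ^ (1 - 1) * Y ^ (k - 1)" V] True k3 by (meson diff_less leD le_trans less_le_trans zero_less_numeral zero_less_one order_refl)
    then have "Y ^ (k - 1) \<in> I" by simp
    then have "\<not> k - 1 \<le> j" using Y_power_mono j(3) by blast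
    \<comment> \<open>Now j <= k - 2 bounds dim T, and k + (k - 2) >= k + 3 would need k >=
      5.\<close>
    then show False using True dim_V_T j k_le by linarith
  next
    case False
    then have V: "vec.dim V < k" using dim_V_le by linarith
    \<comment> \<open>dim V <= k - 1, dim T <= j <= k and dim V + dim T >= k + 3 leave no slack for
      k <= 4.\<close>
    then have k4: "k = 4" "j = 4" "vec.dim V = 3" "vec.dim T = 4"
      using dim_V_T j k_le by linarith+
    obtain E where E: "Vector_Spaces.linear (*s) (*s) E" "V = {v. E v = 0}"
      "\<forall>w. \<exists>s. D w = E w + s *s y" "vec.dim T = Suc (vec.dim (range E))"
      using normalized_differential by (elim exE conjE)
    have "hom (int 4) (Y ^ 4)" using hom_XY[of 0 4] by simp
    then have "vec.dim (ann (Y ^ 4)) \<le> vec.dim T"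
      using dim_ann[of 4 "Y ^ 4" "ann (Y ^ 4)"] j(3) k4 by simp
    then have T: "T = ann (Y ^ 4)"
      using vec.subspace_dim_equal[OF _ subspace_ann] j(4) k4 unfolding T_def by simp
    have VT: "V \<subseteq> T"
      using V_ann[of 1 4] XY_in[of 4 1] k4 unfolding T by simp
    have XY3: "V \<subseteq> ann (X * Y ^ 3)"
      using V_ann[of 2 3] XY_in[of 3 2] k4 by simp
    \<comment> \<open>Write v = s y + D_w y. From X Y^3 v = 0 and X Y^4 = 0 follows X Y^3 D_w y = 0;
      the jet of X Y^4 then gives Y^4 w = 0, so w is in T. As E kills V and dim T - dim V = 1, the
      right side has dimension at most 2, less than dim V = 3.\<close>
    have "V \<subseteq> vec.span (insert y (E ` T))"
    proof
      fix v assume v: "v \<in> V"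
      then have "v \<in> vec.span (insert y (range D))"
        using VT unfolding T_def by blast
      then obtain s where s: "v - s *s y \<in> vec.span (range D)"
        unfolding vec.span_breakdown_eq by (elim exE)
      then obtain w where w: "v = s *s y + D w"
        by (auto simp: D.span_image diff_eq_eq add.commute)
      have "X * Y ^ 3 * lf v \<in> I" using XY3 v by (auto simp: ann_def)
      then have "cst s * (X ^ 1 * Y ^ 4) + X * Y ^ 3 * lf (D w) \<in> I"
        by (simp add: w lf_add lf_scale distrib_left numeral_eq_Suc mult_ac)
      then have XYD: "X * Y ^ 3 * lf (D w) \<in> I"
        by (rule I_add_cancel') (rule I_mult, rule XY_in, use k4 in auto)
      have "of_nat 1 * X ^ (1 - 1) * Y ^ 4 * lf w + of_nat 4 * X ^ 1 * Y ^ (4 - 1) * lf (D w) \<in> I"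
        using XY_in[of 4 1] k4 by (intro jet) auto
      then have "Y ^ 4 * lf w + of_nat 4 * (X * Y ^ 3 * lf (D w)) \<in> I"
        by (simp add: mult.assoc)
      then have "Y ^ 4 * lf w \<in> I"
        by (rule I_add_cancel) (rule I_mult[OF XYD])
      then have "w \<in> T" by (simp add: T ann_def)
      obtain s' where "D w = E w + s' *s y" using E(3) by blast
      then have "v = (s + s') *s y + E w"
        by (simp add: w vec.scale_left_distrib)
      also have "\<dots> \<in> vec.span (insert y (E ` T))"
        using \<open>w \<in> T\<close> by (intro vec.span_add vec.span_scale vec.span_base) auto
      finally show "v \<in> vec.span (insert y (E ` T))" .
    qed
    then have "vec.dim V \<le> vec.dim (insert y (E ` T))"
      by (rule vec.dim_mono)
    also have "\<dots> \<le> Suc (vec.dim (E ` T))"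
      by (simp add: vec.dim_insert)
    finally have "3 \<le> Suc (vec.dim (E ` T))" using k4 by simp
    moreover have "vec.dim (E ` T) + vec.dim V \<le> vec.dim T"
      using E(2) by (intro dim_image_quotient[OF E(1) VT]) auto
    ultimately show False using k4 by linarith
  qed
qed

end

subsection \<open>Polynomial functions\<close>

definition polyfun :: "(('v::finite \<Rightarrow> 'k::field_char_0) \<Rightarrow> 'k) \<Rightarrow> bool" where
  "polyfun f \<longleftrightarrow> (\<exists>F. f = mpeval F)"

definition mon_eval :: "('v::finite \<Rightarrow> 'k::comm_ring_1) \<Rightarrow> ('v \<Rightarrow>\<^sub>0 nat) \<Rightarrow> 'k" where
  "mon_eval c m = (\<Prod>v\<in>UNIV. c v ^ Poly_Mapping.lookup m v)"

lemma mon_eval_add: "mon_eval c (m + m') = mon_eval c m * mon_eval c m'"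
  by (simp add: mon_eval_def lookup_add power_add prod.distrib)

lemma mpeval_superset:
  fixes F :: "('v::finite, 'k::comm_ring_1) mpoly"
  assumes "finite A" "Poly_Mapping.keys F \<subseteq> A"
  shows "mpeval F c = (\<Sum>m\<in>A. Poly_Mapping.lookup F m * mon_eval c m)"
proof -
  have "(\<Prod>v\<in>Poly_Mapping.keys m. c v ^ Poly_Mapping.lookup m v) = mon_eval c m" for m
    unfolding mon_eval_def
    by (intro prod.mono_neutral_left) (auto simp: not_in_keys_iff_lookup_eq_zero)
  then have "mpeval F c = (\<Sum>m\<in>Poly_Mapping.keys F. Poly_Mapping.lookup F m * mon_eval c m)"
    by (simp add: mpeval_def)
  also have "\<dots> = (\<Sum>m\<in>A. Poly_Mapping.lookup F m * mon_eval c m)"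
    using assms by (intro sum.mono_neutral_left) (auto simp: not_in_keys_iff_lookup_eq_zero)
  finally show ?thesis .
qed

lemma mpeval_0 [simp]: "mpeval 0 c = 0"
  by (simp add: mpeval_def)

lemma mpeval_add:
  fixes F G :: "('v::finite, 'k::comm_ring_1) mpoly"
  shows "mpeval (F + G) c = mpeval F c + mpeval G c"
proof -
  let ?A = "Poly_Mapping.keys F \<union> Poly_Mapping.keys G"
  have "Poly_Mapping.keys (F + G) \<subseteq> ?A" by (rule keys_add)
  then show ?thesis
    by (simp add: mpeval_superset[of ?A] lookup_add distrib_right sum.distrib)
qed

lemma mpeval_sum:
  fixes F :: "'i \<Rightarrow> ('v::finite, 'k::comm_ring_1) mpoly"
  shows "mpeval (\<Sum>i\<in>A. F i) c = (\<Sum>i\<in>A. mpeval (F i) c)"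
  by (induction A rule: infinite_finite_induct) (simp_all add: mpeval_add)

lemma mpeval_single:
  fixes a :: "'k::comm_ring_1" and c :: "'v::finite \<Rightarrow> 'k"
  shows "mpeval (Poly_Mapping.single m a) c = a * mon_eval c m"
  by (subst mpeval_superset[of "{m}"]) auto

lemma mpeval_mult:
  fixes F G :: "('v::finite, 'k::comm_ring_1) mpoly"
  shows "mpeval (F * G) c = mpeval F c * mpeval G c"
proof -
  let ?s = "\<lambda>q m. Poly_Mapping.single m (Poly_Mapping.lookup q m)"
  have "mpeval (F * G) c
      = mpeval ((\<Sum>m\<in>Poly_Mapping.keys F. ?s F m) * (\<Sum>m'\<in>Poly_Mapping.keys G. ?s G m')) c"
    by (simp only: mpoly_sum[symmetric])
  also have "\<dots> = (\<Sum>m\<in>Poly_Mapping.keys F. \<Sum>m'\<in>Poly_Mapping.keys G. mpeval (?s F m) c * mpeval (?s G m') c)"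
    by (simp only: sum_product mpeval_sum mult_single mpeval_single mon_eval_add) (simp only: mult_ac)
  also have "\<dots> = mpeval (\<Sum>m\<in>Poly_Mapping.keys F. ?s F m) c * mpeval (\<Sum>m'\<in>Poly_Mapping.keys G. ?s G m') c"
    by (simp only: sum_product mpeval_sum)
  also have "\<dots> = mpeval F c * mpeval G c"
    by (simp only: mpoly_sum[symmetric])
  finally show ?thesis .
qed

lemma polyfun_const: "polyfun (\<lambda>c :: 'v::finite \<Rightarrow> 'k::field_char_0. a)"
proof -
  have "(\<lambda>c :: 'v \<Rightarrow> 'k. a) = mpeval (Poly_Mapping.single 0 a)"
    by (simp add: fun_eq_iff mpeval_single mon_eval_def)
  then show ?thesis unfolding polyfun_def by blast
qed

lemma polyfun_coord: "polyfun (\<lambda>c :: 'v::finite \<Rightarrow> 'k::field_char_0. c v)"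
proof -
  have *: "mon_eval c (Poly_Mapping.single v 1) = c v" for c :: "'v \<Rightarrow> 'k"
  proof -
    have "mon_eval c (Poly_Mapping.single v 1) = (\<Prod>u\<in>UNIV. if u = v then c u else 1)"
      unfolding mon_eval_def by (intro prod.cong refl) (auto simp: lookup_single when_def)
    then show ?thesis by simp
  qed
  have "(\<lambda>c :: 'v \<Rightarrow> 'k. c v) = mpeval (Poly_Mapping.single (Poly_Mapping.single v 1) 1)"
    unfolding fun_eq_iff mpeval_single * by simp
  then show ?thesis unfolding polyfun_def by blast
qed

lemma polyfun_add:
  assumes "polyfun f" "polyfun g"
  shows "polyfun (\<lambda>c. f c + g c)"
proof -
  obtain F G where "f = mpeval F" "g = mpeval G"
    using assms by (auto simp: polyfun_def)
  then have "(\<lambda>c. f c + g c) = mpeval (F + G)"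
    by (simp add: fun_eq_iff mpeval_add)
  then show ?thesis unfolding polyfun_def by (rule exI)
qed

lemma polyfun_mult:
  assumes "polyfun f" "polyfun g"
  shows "polyfun (\<lambda>c. f c * g c)"
proof -
  obtain F G where "f = mpeval F" "g = mpeval G"
    using assms by (auto simp: polyfun_def)
  then have "(\<lambda>c. f c * g c) = mpeval (F * G)"
    by (simp add: fun_eq_iff mpeval_mult)
  then show ?thesis unfolding polyfun_def by (rule exI)
qed

lemma polyfun_uminus: "polyfun f \<Longrightarrow> polyfun (\<lambda>c. - f c)"
  using polyfun_mult[OF polyfun_const[of "- 1"], of f] by simp

lemma polyfun_diff:
  assumes "polyfun f" "polyfun g"
  shows "polyfun (\<lambda>c. f c - g c)"
  using polyfun_add[OF assms(1) polyfun_uminus[OF assms(2)]] by simp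

lemma polyfun_sum: "(\<And>i. i \<in> A \<Longrightarrow> polyfun (f i)) \<Longrightarrow> polyfun (\<lambda>c. \<Sum>i\<in>A. f i c)"
  by (induction A rule: infinite_finite_induct) (simp_all add: polyfun_const polyfun_add)

lemma polyfun_line:
  fixes f :: "('v::finite \<Rightarrow> 'k::field_char_0) \<Rightarrow> 'k"
  assumes "polyfun f"
  shows "\<exists>p. \<forall>t. f (\<lambda>v. c v + t * w v) = poly p t"
proof -
  obtain F where F: "f = mpeval F" using assms by (auto simp: polyfun_def)
  let ?p = "\<Sum>m\<in>Poly_Mapping.keys F. [:Poly_Mapping.lookup F m:] * (\<Prod>v\<in>UNIV. [:c v, w v:] ^ Poly_Mapping.lookup m v)"
  have "f (\<lambda>v. c v + t * w v) = poly ?p t" for t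
    unfolding F mpeval_superset[OF finite_keys subset_refl]
    by (simp add: mon_eval_def poly_sum poly_prod)
  then show ?thesis by blast
qed

text \<open>On the line through a and b both functions become nonzero univariate polynomials, and
  their product has only finitely many roots.\<close>

lemma polyfun_common_nonzero:
  fixes f g :: "('v::finite \<Rightarrow> 'k::field_char_0) \<Rightarrow> 'k"
  assumes "polyfun f" "polyfun g" "f a \<noteq> 0" "g b \<noteq> 0"
  shows "\<exists>c. f c * g c \<noteq> 0"
proof -
  obtain p where p: "\<And>t. f (\<lambda>v. a v + t * (b v - a v)) = poly p t"
    using polyfun_line[OF assms(1), of a "\<lambda>v. b v - a v"] by blast
  obtain q where q: "\<And>t. g (\<lambda>v. a v + t * (b v - a v)) = poly q t"
    using polyfun_line[OF assms(2), of a "\<lambda>v. b v - a v"] by blast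
  have "poly p 0 \<noteq> 0" "poly q 1 \<noteq> 0"
    using p[of 0] q[of 1] assms(3,4) by simp_all
  then have "p * q \<noteq> 0" by auto
  then have "finite {t. poly (p * q) t = 0}" by (rule poly_roots_finite)
  then have "{t. poly (p * q) t = 0} \<noteq> UNIV"
    using infinite_UNIV_char_0 by metis
  then obtain t where "poly (p * q) t \<noteq> 0" by blast
  then show ?thesis
    by (intro exI[of _ "\<lambda>v. a v + t * (b v - a v)"]) (simp add: p q)
qed

lemma polyfun_finite_common_nonzero:
  fixes f :: "'i \<Rightarrow> ('v::finite \<Rightarrow> 'k::field_char_0) \<Rightarrow> 'k"
  assumes "finite S" "\<And>s. s \<in> S \<Longrightarrow> polyfun (f s)" "\<And>s. s \<in> S \<Longrightarrow> \<exists>c. f s c \<noteq> 0"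
  shows "\<exists>c. \<forall>s\<in>S. f s c \<noteq> 0"
proof -
  have "\<exists>g. polyfun g \<and> (\<exists>c. g c \<noteq> 0) \<and> (\<forall>c. g c \<noteq> 0 \<longrightarrow> (\<forall>s\<in>S. f s c \<noteq> 0))"
    using assms
  proof (induction S rule: finite_induct)
    case empty
    show ?case by (intro exI[of _ "\<lambda>c. 1"]) (simp add: polyfun_const)
  next
    case (insert s S)
    then obtain g a b where g: "polyfun g" "g a \<noteq> 0" "\<forall>c. g c \<noteq> 0 \<longrightarrow> (\<forall>s\<in>S. f s c \<noteq> 0)"
      and b: "f s b \<noteq> 0"
      by (metis insertI1 insertI2)
    have "\<exists>c. g c * f s c \<noteq> 0"
      using insert.prems(1) by (intro polyfun_common_nonzero[of g "f s" a b] g(1,2) b) simp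
    moreover have "polyfun (\<lambda>c. g c * f s c)"
      using insert.prems(1) g(1) by (intro polyfun_mult) auto
    ultimately show ?case
      using g(3) by (intro exI[of _ "\<lambda>c. g c * f s c"]) simp
  qed
  then show ?thesis by blast
qed

subsection \<open>Functionals on the quotient ring\<close>

definition functional :: "('v::finite, 'k::field_char_0) mpoly set \<Rightarrow> (('v, 'k) mpoly \<Rightarrow> 'k) \<Rightarrow> bool" where
  "functional I l \<longleftrightarrow> (\<forall>p q. l (p + q) = l p + l q) \<and> (\<forall>a p. l (cst a * p) = a * l p) \<and> (\<forall>p\<in>I. l p = 0)"

lemma functionalD:
  assumes "functional I l"
  shows functional_add: "l (p + q) = l p + l q"
    and functional_cst: "l (cst a * p) = a * l p"
    and functional_in: "p \<in> I \<Longrightarrow> l p = 0"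
  using assms by (auto simp: functional_def)

lemma functional_0: "functional I l \<Longrightarrow> l 0 = 0"
  using functional_cst[of I l 0 0] by simp

lemma functional_sum: "functional I l \<Longrightarrow> l (\<Sum>i\<in>A. p i) = (\<Sum>i\<in>A. l (p i))"
  by (induction A rule: infinite_finite_induct) (simp_all add: functional_0 functional_add)

lemma functional_diff: "functional I l \<Longrightarrow> l (p - q) = l p - l q"
  using functional_add[of I l "p - q" q] by simp

lemma functional_comb:
  "functional I l \<Longrightarrow> functional I l' \<Longrightarrow> functional I (\<lambda>p. a * l p - b * l' p)"
  by (simp add: functional_def algebra_simps)

lemma functional_scale: "functional I l \<Longrightarrow> functional I (\<lambda>p. a * l p)"
  by (simp add: functional_def algebra_simps)

lemma functional_sum_fun:
  "(\<And>u. u \<in> A \<Longrightarrow> functional I (l u)) \<Longrightarrow> functional I (\<lambda>p. \<Sum>u\<in>A. a u * l u p)"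
  unfolding functional_def by (simp add: distrib_left sum.distrib sum_distrib_left mult_ac)

text \<open>A field basis of the ideal stays independent when p is added, so a linear map may be 0
  on the basis and 1 at p.\<close>

lemma functional_separates:
  fixes X :: "('v::finite, 'k::field_char_0) mpoly set"
  assumes "p \<notin> idl.span X"
  shows "\<exists>l. functional (idl.span X) l \<and> l p \<noteq> 0"
proof -
  interpret P: vector_space_pair kscale "(*) :: 'k \<Rightarrow> 'k \<Rightarrow> 'k" ..
  have sub: "kv.subspace (idl.span X)"
    by (rule kv.subspaceI) (simp_all add: kscale_def idl.span_zero idl.span_add idl.span_scale)
  obtain B where B: "B \<subseteq> idl.span X" "kv.independent B" "idl.span X \<subseteq> kv.span B"
    using kv.maximal_independent_subset by blast
  then have "kv.span B \<subseteq> idl.span X"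
    using kv.span_minimal[OF _ sub] by blast
  then have p: "p \<notin> kv.span B" "p \<notin> B"
    using assms B(1) by auto
  then have "kv.independent (insert p B)"
    using kv.independent_insertI B(2) by blast
  then obtain l where l: "Vector_Spaces.linear kscale (*) l" "\<And>x. x \<in> insert p B \<Longrightarrow> l x = (if x = p then 1 else 0)"
    using P.linear_independent_extend[of "insert p B" "\<lambda>x. if x = p then 1 else 0"] by blast
  interpret l: Vector_Spaces.linear kscale "(*)" l by (rule l(1))
  have "l x = 0" if "x \<in> idl.span X" for x
  proof (rule l.eq_0_on_span)
    show "x \<in> kv.span B" using that B(3) by blast
    show "l b = 0" if "b \<in> B" for b using l(2)[of b] that p(2) by auto
  qed
  then have "functional (idl.span X) l"
    using l.add l.scale by (auto simp: functional_def kscale_def)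
  moreover have "l p \<noteq> 0" using l(2)[of p] by simp
  ultimately show ?thesis by blast
qed

text \<open>Expresses without coordinates on the quotient that the class of P c depends polynomially
  on c. The extra factor p makes the notion stable under multiplication by linear forms.\<close>

definition polyfam :: "('v::finite, 'k::field_char_0) mpoly set \<Rightarrow> (('v \<Rightarrow> 'k) \<Rightarrow> ('v, 'k) mpoly) \<Rightarrow> bool" where
  "polyfam I P \<longleftrightarrow> (\<forall>l p. functional I l \<longrightarrow> polyfun (\<lambda>c. l (P c * p)))"

lemma polyfam_1: "polyfam I (\<lambda>c. 1)"
  by (simp add: polyfam_def polyfun_const)

lemma polyfam_linform:
  assumes "polyfam I P" "\<And>v. polyfun (g v)"
  shows "polyfam I (\<lambda>c. linform (\<lambda>v. g v c) * P c)"
  unfolding polyfam_def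
proof (intro allI impI)
  fix l p assume l: "functional I l"
  have "linform (\<lambda>v. g v c) * P c * p = (\<Sum>v\<in>UNIV. cst (g v c) * (P c * (var v * p)))" for c
    by (simp add: linform_sum sum_distrib_right mult.assoc mult.left_commute)
  then have "(\<lambda>c. l (linform (\<lambda>v. g v c) * P c * p)) = (\<lambda>c. \<Sum>v\<in>UNIV. g v c * l (P c * (var v * p)))"
    by (simp add: functional_sum[OF l] functional_cst[OF l])
  moreover have "polyfun (\<lambda>c. l (P c * q))" for q
    using assms(1) l by (auto simp: polyfam_def)
  ultimately show "polyfun (\<lambda>c. l (linform (\<lambda>v. g v c) * P c * p))"
    using assms(2) by (simp add: polyfun_sum polyfun_mult)
qed

lemma polyfam_monomial:
  assumes "\<And>v. polyfun (g v)" "\<And>v. polyfun (h v)"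
  shows "polyfam I (\<lambda>c. linform (\<lambda>v. g v c) ^ a * linform (\<lambda>v. h v c) ^ b)"
proof -
  have "polyfam I (\<lambda>c. linform (\<lambda>v. h v c) ^ b)"
    by (induction b) (simp_all add: polyfam_1 polyfam_linform assms)
  then show ?thesis
    by (induction a) (simp_all add: polyfam_linform assms mult.assoc)
qed

text \<open>Fraction-free elimination on the columns x^k var v, with x = linform c; the functionals gamma v are
the rows of a left inverse up to the factor F.\<close>

lemma kernel_family_or_left_inverse:
  fixes qs :: "('v::finite, 'k::field_char_0) mpoly set"
  defines "I \<equiv> idl.span qs"
  shows "(\<exists>y. (\<forall>v. polyfun (y v)) \<and> (\<forall>v c. v \<notin> C \<longrightarrow> y v c = 0) \<and> (\<exists>v c. y v c \<noteq> 0) \<and>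
       (\<forall>c. linform c ^ k * linform (\<lambda>v. y v c) \<in> I)) \<or>
    (\<exists>F \<gamma>. polyfun F \<and> (\<exists>c. F c \<noteq> 0) \<and> (\<forall>v\<in>C. (\<forall>c. functional I (\<gamma> v c)) \<and>
       (\<forall>u. polyfun (\<lambda>c. \<gamma> v c (linform c ^ k * var u))) \<and>
       (\<forall>u\<in>C. \<forall>c. \<gamma> v c (linform c ^ k * var u) = (if u = v then F c else 0))))"
    (is "?L C \<or> ?R C")
proof (induction C rule: finite_induct[OF finite])
  case 1
  show ?case
    by (intro disjI2 exI[of _ "\<lambda>c. 1"] exI[of _ undefined]) (simp add: polyfun_const)
next
  case (2 v C)
  define e where "e u c = linform c ^ k * var u" for u :: 'v and c :: "'v \<Rightarrow> 'k"
  have e_poly: "polyfun (\<lambda>c. l (e u c))" if "functional I l" for l u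
  proof -
    have "polyfam I (\<lambda>c. linform (\<lambda>v. c v) ^ k * linform (\<lambda>v. 0) ^ 0)"
      by (intro polyfam_monomial polyfun_coord polyfun_const)
    then show ?thesis using that by (simp add: polyfam_def e_def)
  qed
  from 2(3) show ?case
  proof
    assume "?L C"
    then show ?thesis by (intro disjI1) (metis insertI2)
  next
    assume "?R C"
    then obtain F \<gamma> where F: "polyfun F" "\<exists>c. F c \<noteq> 0"
      and \<gamma>: "\<And>u c. u \<in> C \<Longrightarrow> functional I (\<gamma> u c)"
         "\<And>u w. u \<in> C \<Longrightarrow> polyfun (\<lambda>c. \<gamma> u c (e w c))"
         "\<And>u w c. u \<in> C \<Longrightarrow> w \<in> C \<Longrightarrow> \<gamma> u c (e w c) = (if w = u then F c else 0)"
      unfolding e_def by (elim exE conjE) blast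
    define g where "g u c = \<gamma> u c (e v c)" for u c
    \<comment> \<open>The new column times F, reduced so that every old \<gamma> u vanishes on it.
      If r is identically zero modulo I, its coefficients form the kernel family.\<close>
    define r where "r c = cst (F c) * e v c - (\<Sum>u\<in>C. cst (g u c) * e u c)" for c
    show ?thesis
    proof (cases "\<forall>c. r c \<in> I")
      case True
      define y where "y u = (if u = v then F else if u \<in> C then (\<lambda>c. - g u c) else (\<lambda>c. 0))" for u
      have "linform (\<lambda>u. y u c) = (\<Sum>u\<in>insert v C. cst (y u c) * var u)" for c
        unfolding linform_sum by (intro sum.mono_neutral_right) (auto simp: y_def)
      then have "linform (\<lambda>u. y u c) = cst (F c) * var v - (\<Sum>u\<in>C. cst (g u c) * var u)" for c
      proof -
        have "(\<Sum>u\<in>C. cst (y u c) * var u) = (\<Sum>u\<in>C. - (cst (g u c) * var u))"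
          using 2(2) by (intro sum.cong refl) (auto simp: y_def cst_uminus)
        then show ?thesis
          using \<open>linform (\<lambda>u. y u c) = _\<close> 2(1,2) by (simp add: sum_negf y_def)
      qed
      then have "linform c ^ k * linform (\<lambda>u. y u c) = r c" for c
        by (simp add: r_def e_def right_diff_distrib sum_distrib_left mult_ac)
      then have "\<forall>c. linform c ^ k * linform (\<lambda>u. y u c) \<in> I" using True by simp
      moreover have "polyfun (y u)" for u
        using F(1) \<gamma>(2)[of u v] by (auto simp: y_def g_def polyfun_const intro: polyfun_uminus)
      moreover have "\<exists>u c. y u c \<noteq> 0"
        using F(2) by (intro exI[of _ v]) (simp add: y_def)
      moreover have "\<forall>u c. u \<notin> insert v C \<longrightarrow> y u c = 0"
        by (simp add: y_def)
      ultimately show ?thesis by (intro disjI1 exI[of _ y]) blast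
    next
      case False
      then obtain c0 where "r c0 \<notin> I" by blast
      then obtain l where l: "functional I l" "l (r c0) \<noteq> 0"
        unfolding I_def using functional_separates by blast
      \<comment> \<open>F times l, corrected to vanish on the old columns; on the new column its
        value is l (r c). The factor 1 fits the shape of \<open>functional_comb\<close>.\<close>
      define \<rho> where "\<rho> c p = F c * l p - 1 * (\<Sum>u\<in>C. l (e u c) * \<gamma> u c p)" for c p
      define R where "R c = l (r c)" for c
      have \<rho>_fun: "functional I (\<rho> c)" for c
        unfolding \<rho>_def using l(1) \<gamma>(1) by (intro functional_comb functional_sum_fun)
      have \<rho>_C: "\<rho> c (e w c) = 0" if "w \<in> C" for w c
      proof -
        have "(\<Sum>u\<in>C. l (e u c) * \<gamma> u c (e w c)) = (\<Sum>u\<in>C. if u = w then l (e u c) * F c else 0)"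
          using that \<gamma>(3) by (intro sum.cong refl) auto
        then show ?thesis using 2(1) that by (simp add: \<rho>_def mult.commute)
      qed
      have \<rho>_v: "\<rho> c (e v c) = R c" for c
        by (simp add: \<rho>_def R_def r_def g_def functional_diff[OF l(1)] functional_cst[OF l(1)] functional_sum[OF l(1)] mult.commute[of "l _"])
      have \<rho>_poly: "polyfun (\<lambda>c. \<rho> c (e w c))" for w
        unfolding \<rho>_def by (intro polyfun_diff polyfun_mult polyfun_sum F(1) e_poly[OF l(1)] polyfun_const \<gamma>(2))
      have R_poly: "polyfun R"
        using \<rho>_poly[of v] unfolding \<rho>_v .
      have g_poly: "polyfun (g u)" if "u \<in> C" for u
        using \<gamma>(2)[OF that, of v] unfolding g_def .
      \<comment> \<open>One elimination step without division: the entries of the old rows in the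
        new column are cleared by \<rho>, and the common diagonal entry becomes F c * R c.\<close>
      define \<gamma>' where "\<gamma>' u c p = (if u = v then F c * \<rho> c p else R c * \<gamma> u c p - g u c * \<rho> c p)" for u c p
      have nz: "\<exists>c. F c * R c \<noteq> 0"
        using F(2) l(2) polyfun_common_nonzero[OF F(1) R_poly] by (auto simp: R_def)
      have fun': "functional I (\<gamma>' u c)" if "u \<in> insert v C" for u c
        using that 2(2) \<rho>_fun \<gamma>(1) unfolding \<gamma>'_def
        by (cases "u = v") (auto intro: functional_scale functional_comb)
      have poly': "polyfun (\<lambda>c. \<gamma>' u c (e w c))" if "u \<in> insert v C" for u w
        using that 2(2) unfolding \<gamma>'_def
        by (cases "u = v") (auto intro!: polyfun_diff polyfun_mult F(1) \<rho>_poly R_poly g_poly \<gamma>(2))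
      have val': "\<gamma>' u c (e w c) = (if w = u then F c * R c else 0)"
        if "u \<in> insert v C" "w \<in> insert v C" for u w c
      proof (cases "u = v")
        case True
        then show ?thesis using that \<rho>_C[of w c] \<rho>_v 2(2) by (auto simp: \<gamma>'_def)
      next
        case False
        then have "u \<in> C" using that by simp
        then show ?thesis
          using that False \<gamma>(3)[of u w c] \<rho>_C[of w c] \<rho>_v 2(2)
          by (cases "w = v") (auto simp: \<gamma>'_def g_def)
      qed
      have "?R (insert v C)"
        using nz fun' poly' val' polyfun_mult[OF F(1) R_poly]
        unfolding e_def by (intro exI[of _ "\<lambda>c. F c * R c"] exI[of _ \<gamma>'] conjI ballI allI) blast+
      then show ?thesis ..
    qed
  qed
qed

subsection \<open>Differentiating along a line\<close>

lemma coeff_power_01: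
  fixes P :: "'a::comm_ring_1 poly"
  shows "coeff (P ^ n) 0 = coeff P 0 ^ n \<and> coeff (P ^ n) 1 = of_nat n * coeff P 0 ^ (n - 1) * coeff P 1"
proof (induction n)
  case (Suc n)
  have "coeff (P ^ Suc n) 1 = coeff P 0 * coeff (P ^ n) 1 + coeff P 1 * coeff (P ^ n) 0"
    by (simp add: coeff_mult)
  also have "\<dots> = of_nat (Suc n) * coeff P 0 ^ n * coeff P 1"
    using Suc.IH by (cases n) (simp_all add: algebra_simps)
  finally show ?case using Suc.IH by (simp add: coeff_mult)
qed simp

text \<open>A functional vanishing on the ideal maps P to a univariate polynomial over an infinite
  field with all values zero, hence to zero.\<close>

lemma coeff_in_ideal_of_values:
  fixes P :: "('v::finite, 'k::field_char_0) mpoly poly"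
  assumes "\<And>t. poly P (cst t) \<in> idl.span X"
  shows "coeff P i \<in> idl.span X"
proof (rule ccontr)
  assume "coeff P i \<notin> idl.span X"
  then obtain l where l: "functional (idl.span X) l" "l (coeff P i) \<noteq> 0"
    using functional_separates by blast
  define Q where "Q = map_poly l P"
  have coeffQ: "coeff Q j = l (coeff P j)" for j
    unfolding Q_def by (rule coeff_map_poly) (rule functional_0[OF l(1)])
  have cst_power: "cst t ^ j = (cst (t ^ j) :: ('v, 'k) mpoly)" for t j
    by (induction j) (simp_all add: cst_mult)
  have "degree Q \<le> degree P"
    by (rule degree_le) (simp add: coeffQ coeff_eq_0 functional_0[OF l(1)])
  have "poly Q t = 0" for t
  proof -
    have "poly Q t = (\<Sum>j\<le>degree P. coeff Q j * t ^ j)"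
      unfolding poly_altdef using \<open>degree Q \<le> degree P\<close>
      by (intro sum.mono_neutral_left) (auto simp: coeff_eq_0)
    also have "\<dots> = l (\<Sum>j\<le>degree P. coeff P j * cst t ^ j)"
      by (simp add: functional_sum[OF l(1)] cst_power coeffQ mult.commute[of _ "cst _"] functional_cst[OF l(1)])
        (simp add: mult.commute)
    also have "\<dots> = 0"
      using assms[of t] functional_in[OF l(1)] by (simp add: poly_altdef)
    finally show ?thesis .
  qed
  then have "\<forall>t. poly Q t = 0" by blast
  then have "Q = 0" by (simp only: poly_all_0_iff_0)
  then show False using coeffQ[of i] l(2) by simp
qed

text \<open>On the line c + t w the monomial is a polynomial in t with all values in the ideal, and
  the claim concerns its coefficient of t. The vector d precedes a and b: it is the derivative of y
  at c along w, common to all monomials.\<close>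

lemma derivative_in_ideal:
  fixes y :: "'v::finite \<Rightarrow> ('v \<Rightarrow> 'k::field_char_0) \<Rightarrow> 'k"
  assumes y: "\<And>v. polyfun (y v)"
  shows "\<exists>d. \<forall>a b. (\<forall>c. linform c ^ a * linform (\<lambda>v. y v c) ^ b \<in> idl.span qs) \<longrightarrow>
     of_nat a * linform c ^ (a - 1) * linform (\<lambda>v. y v c) ^ b * linform w
     + of_nat b * linform c ^ a * linform (\<lambda>v. y v c) ^ (b - 1) * linform d \<in> idl.span qs"
proof -
  have "\<forall>v. \<exists>p. \<forall>t. y v (\<lambda>u. c u + t * w u) = poly p t"
    using polyfun_line[OF y] by blast
  then obtain p where p: "\<And>v t. y v (\<lambda>u. c u + t * w u) = poly (p v) t"
    by metis
  have poly_map: "poly (map_poly cst q) (cst t) = (cst (poly q t) :: ('v, 'k) mpoly)" for q t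
    by (induction q) (simp_all add: map_poly_pCons cst_add cst_mult)
  define P1 where "P1 = [:linform c, linform w:]"
  define P2 where "P2 = (\<Sum>v\<in>UNIV. smult (var v) (map_poly cst (p v)))"
  have P1: "poly P1 (cst t) = linform (\<lambda>u. c u + t * w u)" for t
    by (simp add: P1_def linform_add linform_scale)
  have P2: "poly P2 (cst t) = linform (\<lambda>v. y v (\<lambda>u. c u + t * w u))" for t
    by (simp add: P2_def poly_sum poly_map linform_sum p mult.commute)
  have P2_coeff: "coeff P2 i = linform (\<lambda>v. coeff (p v) i)" for i
    by (simp add: P2_def coeff_sum linform_sum coeff_map_poly mult.commute)
  have P2_0: "coeff P2 0 = linform (\<lambda>v. y v c)"
    using p[of _ 0] by (simp add: P2_coeff poly_0_coeff_0)
  define d where "d v = coeff (p v) 1" for v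
  have "of_nat a * linform c ^ (a - 1) * linform (\<lambda>v. y v c) ^ b * linform w
     + of_nat b * linform c ^ a * linform (\<lambda>v. y v c) ^ (b - 1) * linform d \<in> idl.span qs"
    if "\<forall>c. linform c ^ a * linform (\<lambda>v. y v c) ^ b \<in> idl.span qs" for a b
  proof -
    have "poly (P1 ^ a * P2 ^ b) (cst t) \<in> idl.span qs" for t
      using that by (simp add: P1 P2)
    then have "coeff (P1 ^ a * P2 ^ b) 1 \<in> idl.span qs"
      by (rule coeff_in_ideal_of_values)
    moreover have "coeff (P1 ^ a * P2 ^ b) 1 = coeff (P1 ^ a) 0 * coeff (P2 ^ b) 1 + coeff (P1 ^ a) 1 * coeff (P2 ^ b) 0"
      by (simp add: coeff_mult)
    moreover have "coeff P1 0 = linform c" "coeff P1 1 = linform w"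
      by (simp_all add: P1_def)
    moreover have "coeff P2 1 = linform d"
      by (simp add: P2_coeff d_def[abs_def])
    ultimately show ?thesis
      by (simp only: coeff_power_01 P2_0) (simp only: mult_ac add_ac)
  qed
  then show ?thesis by blast
qed

subsection \<open>The Lefschetz property\<close>

lemma no_kernel_family:
  fixes qs :: "('v::finite, 'k::field_char_0) mpoly list"
  assumes qs: "rsq {} qs" "\<forall>q\<in>set qs. hom 2 q" "1 \<notin> idl.span (set qs)"
    and k: "k \<le> 4" "k + 2 \<le> CARD('v)"
    and y: "\<And>v. polyfun (y v)" "y v0 c0 \<noteq> 0"
    and ker: "\<And>c. linform c ^ k * linform (\<lambda>v. y v c) \<in> idl.span (set qs)"
  shows False
proof -
  let ?I = "idl.span (set qs)"
  define M where "M s c = linform c ^ fst s * linform (\<lambda>v. y v c) ^ snd s" for s c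
  have M_poly: "polyfun (\<lambda>c. l (M s c))" if "functional ?I l" for l s
  proof -
    have "polyfam ?I (\<lambda>c. linform (\<lambda>v. c v) ^ fst s * linform (\<lambda>v. y v c) ^ snd s)"
      by (intro polyfam_monomial polyfun_coord y(1))
    then have "polyfun (\<lambda>c. l (M s c * 1))"
      using that unfolding polyfam_def M_def by blast
    then show ?thesis by simp
  qed
  \<comment> \<open>Monomials that are not identically zero in the quotient. Each is detected by a
    functional, and finitely many nonzero polynomial functions have a common nonzero c.\<close>
  define S where "S = {s \<in> {..5} \<times> {..5}. \<exists>c. M s c \<notin> ?I}"
  have "finite S" by (simp add: S_def)
  have "\<forall>s. \<exists>l. s \<in> S \<longrightarrow> functional ?I l \<and> (\<exists>c. l (M s c) \<noteq> 0)"
    unfolding S_def using functional_separates by blast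
  then obtain l where l: "\<forall>s. s \<in> S \<longrightarrow> functional ?I (l s) \<and> (\<exists>c. l s (M s c) \<noteq> 0)"
    by (rule choice[THEN exE])
  have "\<exists>c. \<forall>s\<in>S. l s (M s c) \<noteq> 0"
    using l M_poly by (intro polyfun_finite_common_nonzero[OF \<open>finite S\<close>]) blast+
  then obtain c where "\<forall>s\<in>S. l s (M s c) \<noteq> 0" ..
  then have generic: "\<forall>c. M s c \<in> ?I" if "M s c \<in> ?I" "s \<in> {..5} \<times> {..5}" for s
    using that l functional_in unfolding S_def by blast
  have "linform (\<lambda>v. y v c0) \<notin> ?I"
  proof
    assume "linform (\<lambda>v. y v c0) \<in> ?I"
    then have "hcomp 1 (linform (\<lambda>v. y v c0)) = 0"
      using hcomp_ideal_low[OF qs(2), of _ 1] by simp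
    moreover have "hcomp 1 (linform (\<lambda>v. y v c0)) = linform (\<lambda>v. y v c0)"
      using hom_linform by (simp only: hom_iff_hcomp)
    ultimately show False using y(2) by (simp add: linform_eq_0_iff)
  qed
  then have Yc: "linform (\<lambda>v. y v c) \<notin> ?I"
    using generic[of "(0, 1)"] by (auto simp: M_def)
  \<comment> \<open>The exponent may drop below k at c; the bounds k' <= 4 and k' + 2 <= CARD('v)
    are inherited.\<close>
  define k' where "k' = (LEAST j. linform c ^ j * linform (\<lambda>v. y v c) \<in> ?I)"
  have k': "linform c ^ k' * linform (\<lambda>v. y v c) \<in> ?I" "k' \<le> k"
    unfolding k'_def using ker[of c]
    by (rule LeastI[of "\<lambda>j. linform c ^ j * linform (\<lambda>v. y v c) \<in> ?I"],
        rule Least_le[of "\<lambda>j. linform c ^ j * linform (\<lambda>v. y v c) \<in> ?I"])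
  have least: "linform c ^ j * linform (\<lambda>v. y v c) \<notin> ?I" if "j < k'" for j
    using not_less_Least[of j "\<lambda>j. linform c ^ j * linform (\<lambda>v. y v c) \<in> ?I"] that
    unfolding k'_def by blast
  define e where "e u = (\<lambda>v. if v = u then 1 else 0 :: 'k)" for u :: 'v
  have "\<forall>u. \<exists>d. \<forall>a b. (\<forall>c. linform c ^ a * linform (\<lambda>v. y v c) ^ b \<in> ?I) \<longrightarrow>
     of_nat a * linform c ^ (a - 1) * linform (\<lambda>v. y v c) ^ b * linform (e u)
     + of_nat b * linform c ^ a * linform (\<lambda>v. y v c) ^ (b - 1) * linform d \<in> ?I"
    by (rule allI) (rule derivative_in_ideal[OF y(1)])
  then obtain d where d: "\<forall>u a b. (\<forall>c. linform c ^ a * linform (\<lambda>v. y v c) ^ b \<in> ?I) \<longrightarrow>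
     of_nat a * linform c ^ (a - 1) * linform (\<lambda>v. y v c) ^ b * linform (e u)
     + of_nat b * linform c ^ a * linform (\<lambda>v. y v c) ^ (b - 1) * linform (d u) \<in> ?I"
    by (rule choice[THEN exE])
  define yv where "yv = (\<chi> v. y v c)"
  \<comment> \<open>Derivatives are taken in the coordinate directions only and extended linearly;
    the jet relation is linear in w, so it extends with them.\<close>
  define D where "D w = (\<chi> v. \<Sum>u\<in>UNIV. w $ u * d u v)" for w :: "'k ^ 'v"
  have lf_yv: "lf yv = linform (\<lambda>v. y v c)"
    by (rule arg_cong[where f = linform]) (simp add: yv_def fun_eq_iff)
  have lf_D: "lf (D w) = (\<Sum>u\<in>UNIV. cst (w $ u) * linform (d u))" for w
  proof -
    have cst_sum: "cst (\<Sum>u\<in>A. f u) = (\<Sum>u\<in>A. cst (f u) :: ('v, 'k) mpoly)"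
      for f :: "'v \<Rightarrow> 'k" and A
      by (induction A rule: infinite_finite_induct) (simp_all add: cst_add)
    have "lf (D w) = (\<Sum>v\<in>UNIV. \<Sum>u\<in>UNIV. cst (w $ u) * (cst (d u v) * var v))"
      by (simp add: linform_sum D_def cst_sum cst_mult sum_distrib_right mult.assoc)
    also have "\<dots> = (\<Sum>u\<in>UNIV. cst (w $ u) * linform (d u))"
      by (subst sum.swap) (simp add: linform_sum sum_distrib_left)
    finally show ?thesis .
  qed
  have lf_w: "lf w = (\<Sum>u\<in>UNIV. cst (w $ u) * linform (e u))" for w :: "'k ^ 'v"
    unfolding e_def linform_axis by (rule linform_sum)
  have "vanishing_jet qs (linform c) yv D k'"
  proof (rule vanishing_jet.intro)
    show "yv \<noteq> 0"
    proof
      assume "yv = 0"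
      then have "linform (\<lambda>v. y v c) = 0" using lf_eq_0_iff[of yv] lf_yv by simp
      then show False using Yc by (simp add: idl.span_zero)
    qed
    show "Vector_Spaces.linear (*s) (*s) D"
      by (intro Vector_Spaces.linear.intro module_hom.intro module_hom_axioms.intro)
        (simp_all add: vec.vector_space_axioms vec.module_axioms D_def vec_eq_iff distrib_right sum.distrib
          sum_distrib_left mult.assoc)
    fix a b :: nat and w
    assume ab: "a + b \<le> 5" "linform c ^ a * lf yv ^ b \<in> ?I"
    then have "\<forall>c. linform c ^ a * linform (\<lambda>v. y v c) ^ b \<in> ?I"
      using generic[of "(a, b)"] by (simp add: M_def lf_yv)
    then have du: "of_nat a * linform c ^ (a - 1) * linform (\<lambda>v. y v c) ^ b * linform (e u)
       + of_nat b * linform c ^ a * linform (\<lambda>v. y v c) ^ (b - 1) * linform (d u) \<in> ?I" for u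
      using d by blast
    have "(\<Sum>u\<in>UNIV. cst (w $ u) * (of_nat a * linform c ^ (a - 1) * linform (\<lambda>v. y v c) ^ b * linform (e u)
       + of_nat b * linform c ^ a * linform (\<lambda>v. y v c) ^ (b - 1) * linform (d u))) \<in> ?I"
      by (intro idl.span_sum idl.span_scale du)
    then show "of_nat a * linform c ^ (a - 1) * lf yv ^ b * lf w
       + of_nat b * linform c ^ a * lf yv ^ (b - 1) * lf (D w) \<in> ?I"
      unfolding lf_w[of w] lf_D lf_yv
      by (simp add: distrib_left sum.distrib sum_distrib_left mult_ac)
  next
    fix j assume "j < k'"
    then show "linform c ^ j * lf yv \<notin> ?I" using least by (simp add: lf_yv)
  qed (use qs k k' lf_yv in simp_all)
  then interpret vanishing_jet qs "linform c" yv D k' .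
  show False by (rule contradiction)
qed

lemma gen_ideal_eq: "gen_ideal qs = idl.span (set qs)"
  using idl_span_image_lessThan[of "nth qs" "length qs"]
  by (simp add: gen_ideal_def image_nth_lessThan)

lemma regular_sequence_rsq: "regular_sequence qs \<Longrightarrow> rsq {} qs"
  by (auto simp: rsq_iff regular_sequence_def gen_ideal_eq nzd_def)

theorem mainTheorem16:
  fixes qs :: "('v::finite, 'k::field_char_0) mpoly list" and k n :: nat
  assumes "alg_closed_field TYPE('k)"
    and "k \<in> {2, 3, 4}"
    and "card (UNIV :: 'v set) = n + 1"
    and "length qs = n + 1"
    and "\<forall>q\<in>set qs. homogeneous 2 q \<and> q \<noteq> 0"
    and "regular_sequence qs"
    and "n \<ge> k + 1"
  shows "SLP1 k qs"
proof -
  let ?I = "idl.span (set qs)"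
  have qs: "rsq {} qs" "\<forall>q\<in>set qs. hom 2 q" "1 \<notin> ?I"
    using assms(5,6) regular_sequence_rsq
    by (auto simp: homogeneous_iff_hom regular_sequence_def gen_ideal_eq)
  have k: "k \<le> 4" "k + 2 \<le> CARD('v)"
    using assms(2,3,7) by auto
  have "\<not> (\<exists>y. (\<forall>v. polyfun (y v)) \<and> (\<forall>v c. v \<notin> UNIV \<longrightarrow> y v c = 0) \<and> (\<exists>v c. y v c \<noteq> 0) \<and>
       (\<forall>c. linform c ^ k * linform (\<lambda>v. y v c) \<in> ?I))"
    using no_kernel_family[OF qs k] by blast
  then obtain F \<gamma> where F: "polyfun F" "\<exists>c. F c \<noteq> 0"
    and \<gamma>: "\<forall>v\<in>UNIV. (\<forall>c. functional ?I (\<gamma> v c)) \<and>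
       (\<forall>u. polyfun (\<lambda>c. \<gamma> v c (linform c ^ k * var u))) \<and>
       (\<forall>u\<in>UNIV. \<forall>c. \<gamma> v c (linform c ^ k * var u) = (if u = v then F c else 0))"
    using kernel_family_or_left_inverse[of UNIV k "set qs"] by (elim disjE exE conjE) blast+
  \<comment> \<open>The factor of the left inverse is the polynomial demanded by
    \<open>SLP1\<close>.\<close>
  obtain G where G: "F = mpeval G" using F(1) by (auto simp: polyfun_def)
  have "G \<noteq> 0" using F(2) by (auto simp: G)
  moreover have "y1 - y2 \<in> gen_ideal qs"
    if c: "mpeval G c \<noteq> 0" and y: "homogeneous 1 y1" "homogeneous 1 y2"
      and ker: "linform c ^ k * y1 - linform c ^ k * y2 \<in> gen_ideal qs" for c y1 y2
  proof -
    have "hom 1 (y1 - y2)"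
      using y by (simp add: homogeneous_iff_hom hom_diff)
    then obtain d where d: "y1 - y2 = linform d"
      using hom_1_linform by blast
    have "linform c ^ k * (y1 - y2) \<in> ?I"
      using ker by (simp add: gen_ideal_eq right_diff_distrib)
    then have mem: "(\<Sum>v\<in>UNIV. cst (d v) * (linform c ^ k * var v)) \<in> ?I"
      by (simp add: d linform_sum[of d] sum_distrib_left mult.left_commute)
    \<comment> \<open>The row \<gamma> u isolates the coordinate d u up to the factor F c, so the
      difference is zero as a linear form and not merely modulo the ideal.\<close>
    have "d u = 0" for u
    proof -
      have l: "functional ?I (\<gamma> u c)" using \<gamma> by blast
      have val: "\<gamma> u c (linform c ^ k * var v) = (if v = u then F c else 0)" for v
        using \<gamma> by blast
      have "0 = \<gamma> u c (\<Sum>v\<in>UNIV. cst (d v) * (linform c ^ k * var v))"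
        using functional_in[OF l mem] by simp
      also have "\<dots> = (\<Sum>v\<in>UNIV. d v * \<gamma> u c (linform c ^ k * var v))"
        by (simp only: functional_sum[OF l] functional_cst[OF l])
      also have "\<dots> = (\<Sum>v\<in>UNIV. if v = u then d v * F c else 0)"
        by (intro sum.cong refl) (simp add: val)
      also have "\<dots> = d u * F c" by simp
      finally show ?thesis using c by (simp add: G)
    qed
    then have "y1 - y2 = 0" by (simp add: d linform_eq_0_iff)
    then show ?thesis by (simp add: gen_ideal_eq idl.span_zero)
  qed
  ultimately show ?thesis
    unfolding SLP1_def by blast
qed

end
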